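(* Let $H$ be a finitely generated subgroup of $G=G_1\ast_A G_2$. Then the normal core $(\Delta,H\cdot1)$ of $Cayley(G,H)$ is a reduced precover of $G$ with $Lab(\Delta,H\cdot1)=H$.
   Context: Amalgam. $G_1=gp\langle X_1|R_1\rangle$, $G_2=gp\langle X_2|R_2\rangle$ are finitely presented groups given by fixed finite presentations with $X_1^{\pm}\cap X_2^{\pm}=\emptyset$; $A$ is a group with monomorphisms $\phi_i:A\to G_i$ ($i=1,2$); $G=G_1\ast_A G_2=gp\langle X_1,X_2\mid R_1,R_2,\phi_1(A)=\phi_2(A)\rangle$ is given by this finite presentation, $X=X_1\cup X_2$. $A$ is identified with its images in $G_1$, $G_2$ and $G$. Graphs. A graph $\Gamma$ has vertices $V(\Gamma)$, directed edges $E(\Gamma)$, an involution $e\mapsto\overline e\neq e$ on edges, initial vertex $\iota(e)$ and terminal vertex $\tau(e)=\iota(\overline e)$. It is labelled with $X^{\pm}$ if each edge has a label $lab(e)\in X^{\pm}$ with $lab(\overline e)=lab(e)^{-1}$; well-labelled if $\iota(e_1)=\iota(e_2)$, $lab(e_1)=lab(e_2)$ imply $e_1=e_2$. The label of a path is the word read along it. $Lab(\Gamma,v_0)$ is the subgroup of $G$ of all elements represented by labels of closed paths at $v_0$ (if $V(\Gamma)=\{v_0\}$, $E(\Gamma)=\emptyset$, it is $\{1\}$). $\Gamma$ is $G$-based if every path $p$ with $lab(p)=_G1$ is closed. $Cayley(G,S)$ (relative Cayley graph) has vertices the right cosets $Sg$ and, for each $x\in X^{\pm}$, an edge $(Sg,x)$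 labelled $x$ from $Sg$ to $Sgx$; basepoint $S\cdot 1$. $Cayley(G_i,S)$ is defined similarly with $X_i$. A cover of $G_i$ is a labelled graph isomorphic to $Cayley(G_i,S)$ for some $S\le G_i$. Normal paths. A word $g_1g_2\cdots g_n$ is in normal form (normal) if each $g_k\neq_G1$ is a word lying in one of the factors, consecutive $g_k,g_{k+1}$ lie in different factors, and if $n\neq1$ then no $g_k$ is in $A$. A path $p$ with decomposition $p_1\cdots p_n$ into maximal monochromatic subpaths (labelled only by $X_1^{\pm}$ or only by $X_2^{\pm}$) is normal if $lab(p_1)\cdots lab(p_n)$ is in normal form. Normal core. A vertex of $Cayley(G,H)$ is essential if some normal path closed at $H\cdot1$ goes through it. The normal core $(\Delta,H\cdot1)$ of $Cayley(G,H)$ is its restriction to the essential vertices, understood as the union of all normal paths in $Cayley(G,H)$ closed at $H\cdot1$ (it is the single vertex $H\cdot 1$ with no edges if $H=\{1\}$). Precovers. An $X_i$-monochromatic component of $\Gamma$ is a maximal connected subgraph labelled with $X_i^{\pm}$ containing at least one edge. A vertex is bichromatic if edges with labels in $X_1^{\pm}$ and edges with labels in $X_2^{\pm}$ start at it; $VB(C)$ denotes the set of vertices of a component $C$ that are bichromatic in $\Gamma$. A precover of $G$ is a connected $G$-based graph (labelled with $X^\pm$) in which each $X_i$-monochromatic component is a cover of $G_i$ ($i=1,2$); a single vertex with no edges is also a precover. For a vertex $v$ of an $X_i$-monochromatic component $C$ of a precover and $a\in A$, $v\cdot a$ is the endpoint of the path in $C$ starting at $v$ labelled by a word in $X_i^{\pm}$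 representing $a$; $A(v)=\{v\cdot a: a\in A\}$. An $X_i$-monochromatic component $C$ of a precover $(\Gamma,v_0)$ is redundant if either (1) $\Gamma=C$ and $Lab(C,v_0)=\{1\}$; or (2) $\Gamma$ has at least two distinct monochromatic components and, for $\vartheta\in VB(C)$ and $K=Lab(C,\vartheta)$: (i) $K\le A$, (ii) $VB(C)=A(\vartheta)$, (iii) either $v_0\notin V(C)$, or $v_0\in VB(C)$ and $K=\{1\}$. A precover $(\Gamma,v_0)$ is reduced if (1) it has no redundant monochromatic components, and (2) if there is an $X_i$-monochromatic component $C$ with $v_0\in V(C)$ and $K\cap A\neq\{1\}$, where $K=Lab(C,v_0)$, then there is an $X_j$-monochromatic component $D$ ($1\le i\neq j\le2$) with $v_0\in V(D)$ and $K\cap A=_G L\cap A$, where $L=Lab(D,v_0)$. *)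

theory Defs
  imports
    "HOL-Algebra.Coset"
    "HOL-Algebra.Generated_Groups"
    "Graph_Theory.Arc_Walk"
    "Graph_Theory.Digraph_Component"
    "Graph_Theory.Bidirected_Digraph"
    "HOL-Combinatorics.Orbits"
begin

section \<open>Group presentations\<close>

text \<open>A letter \<open>(x, False)\<close> stands for the generator \<open>x\<close>, the letter \<open>(x, True)\<close> for its
  formal inverse.\<close>

type_synonym 'x letter = "'x \<times> bool"
type_synonym 'x word = "'x letter list"

definition inv_letter :: "'x letter \<Rightarrow> 'x letter" where
  "inv_letter l = (fst l, \<not> snd l)"

definition inv_word :: "'x word \<Rightarrow> 'x word" where
  "inv_word w = rev (map inv_letter w)"

definition letters :: "'x set \<Rightarrow> 'x letter set" where
  "letters X = X \<times> UNIV"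

abbreviation words :: "'x set \<Rightarrow> 'x word set" where
  "words X \<equiv> lists (letters X)"

inductive pres_eq :: "'x set \<Rightarrow> 'x word set \<Rightarrow> 'x word \<Rightarrow> 'x word \<Rightarrow> bool" for X R where
  refl: "w \<in> words X \<Longrightarrow> pres_eq X R w w"
| sym: "pres_eq X R u v \<Longrightarrow> pres_eq X R v u"
| trans: "pres_eq X R u v \<Longrightarrow> pres_eq X R v w \<Longrightarrow> pres_eq X R u w"
| cancel: "u \<in> words X \<Longrightarrow> v \<in> words X \<Longrightarrow> l \<in> letters X \<Longrightarrow>
    pres_eq X R (u @ [l, inv_letter l] @ v) (u @ v)"
| relator: "u \<in> words X \<Longrightarrow> v \<in> words X \<Longrightarrow> r \<in> R \<Longrightarrow> r \<in> words X \<Longrightarrow>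
    pres_eq X R (u @ r @ v) (u @ v)"

definition pres_rel :: "'x set \<Rightarrow> 'x word set \<Rightarrow> ('x word \<times> 'x word) set" where
  "pres_rel X R = {(u, v). pres_eq X R u v}"

text \<open>The element of the presented group that a word represents.\<close>

definition elem :: "'x set \<Rightarrow> 'x word set \<Rightarrow> 'x word \<Rightarrow> 'x word set" where
  "elem X R w = pres_rel X R `` {w}"

definition gp :: "'x set \<Rightarrow> 'x word set \<Rightarrow> 'x word set monoid" where
  "gp X R = \<lparr>carrier = words X // pres_rel X R,
             monoid.mult = (\<lambda>P Q. \<Union>u\<in>P. \<Union>v\<in>Q. elem X R (u @ v)),
             one = elem X R []\<rparr>"

definition finitely_generated :: "('a, 'm) monoid_scheme \<Rightarrow> 'a set \<Rightarrow> bool" where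
  "finitely_generated G H \<longleftrightarrow> (\<exists>S. finite S \<and> S \<subseteq> carrier G \<and> generate G S = H)"


section \<open>Labelled graphs\<close>

text \<open>The functions in the fields only matter on the arcs of the graph; this lets a subgraph
  share them with the ambient graph. Since \<^const>\<open>bidirected_digraph\<close> asks for an
  involution that fixes all non-arcs, it is applied to the restriction of \<open>inv_arc\<close>.\<close>

record ('v, 'e, 'x) lgraph =
  dg :: "('v, 'e) pre_digraph"
  inv_arc :: "'e \<Rightarrow> 'e"
  lab :: "'e \<Rightarrow> 'x letter"

abbreviation lverts :: "('v, 'e, 'x) lgraph \<Rightarrow> 'v set" where
  "lverts \<Gamma> \<equiv> verts (dg \<Gamma>)"

abbreviation larcs :: "('v, 'e, 'x) lgraph \<Rightarrow> 'e set" where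
  "larcs \<Gamma> \<equiv> arcs (dg \<Gamma>)"

definition labelled_graph :: "'x set \<Rightarrow> ('v, 'e, 'x) lgraph \<Rightarrow> bool" where
  "labelled_graph X \<Gamma> \<longleftrightarrow>
     bidirected_digraph (dg \<Gamma>) (perm_restrict (inv_arc \<Gamma>) (larcs \<Gamma>)) \<and>
     (\<forall>e\<in>larcs \<Gamma>. lab \<Gamma> e \<in> letters X \<and> lab \<Gamma> (inv_arc \<Gamma> e) = inv_letter (lab \<Gamma> e))"

abbreviation path :: "('v, 'e, 'x) lgraph \<Rightarrow> 'v \<Rightarrow> 'e list \<Rightarrow> 'v \<Rightarrow> bool" where
  "path \<Gamma> u p v \<equiv> pre_digraph.awalk (dg \<Gamma>) u p v"

abbreviation plab :: "('v, 'e, 'x) lgraph \<Rightarrow> 'e list \<Rightarrow> 'x word" where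
  "plab \<Gamma> p \<equiv> map (lab \<Gamma>) p"

definition sub_lgraph :: "('v, 'e, 'x) lgraph \<Rightarrow> ('v, 'e, 'x) lgraph \<Rightarrow> bool" where
  "sub_lgraph C \<Gamma> \<longleftrightarrow>
     subgraph (dg C) (dg \<Gamma>) \<and> inv_arc C = inv_arc \<Gamma> \<and> lab C = lab \<Gamma> \<and>
     inv_arc \<Gamma> ` larcs C \<subseteq> larcs C"

definition lgraph_isomorphic ::
  "('v, 'e, 'x) lgraph \<Rightarrow> ('w, 'f, 'x) lgraph \<Rightarrow> bool" where
  "lgraph_isomorphic \<Gamma> \<Gamma>' \<longleftrightarrow>
     (\<exists>f g. bij_betw f (lverts \<Gamma>) (lverts \<Gamma>') \<and> bij_betw g (larcs \<Gamma>) (larcs \<Gamma>') \<and>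
        (\<forall>e\<in>larcs \<Gamma>.
           tail (dg \<Gamma>') (g e) = f (tail (dg \<Gamma>) e) \<and>
           head (dg \<Gamma>') (g e) = f (head (dg \<Gamma>) e) \<and>
           inv_arc \<Gamma>' (g e) = g (inv_arc \<Gamma> e) \<and>
           lab \<Gamma>' (g e) = lab \<Gamma> e))"

definition mono_subgraph ::
  "'x set \<Rightarrow> ('v, 'e, 'x) lgraph \<Rightarrow> ('v, 'e, 'x) lgraph \<Rightarrow> bool" where
  "mono_subgraph Y \<Gamma> C \<longleftrightarrow>
     sub_lgraph C \<Gamma> \<and> Digraph_Component.connected (dg C) \<and> larcs C \<noteq> {} \<and>
     (\<forall>e\<in>larcs C. lab C e \<in> letters Y)"

definition mono_component ::
  "'x set \<Rightarrow> ('v, 'e, 'x) lgraph \<Rightarrow> ('v, 'e, 'x) lgraph \<Rightarrow> bool" where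
  "mono_component Y \<Gamma> C \<longleftrightarrow>
     mono_subgraph Y \<Gamma> C \<and> (\<forall>C'. mono_subgraph Y \<Gamma> C' \<and> sub_lgraph C C' \<longrightarrow> C' = C)"


section \<open>Relative Cayley graphs and covers\<close>

definition Cayley :: "'x set \<Rightarrow> 'x word set \<Rightarrow> 'x word set set \<Rightarrow>
    ('x word set set, 'x word set set \<times> 'x letter, 'x) lgraph" where
  "Cayley X R S =
     (let head' = (\<lambda>(c, l). c #>\<^bsub>gp X R\<^esub> elem X R [l]) in
      \<lparr>dg = \<lparr>verts = rcosets\<^bsub>gp X R\<^esub> S,
             arcs = (rcosets\<^bsub>gp X R\<^esub> S) \<times> letters X,
             tail = fst,
             head = head'\<rparr>,
       inv_arc = (\<lambda>e. (head' e, inv_letter (snd e))),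
       lab = snd\<rparr>)"

definition is_cover :: "'x set \<Rightarrow> 'x word set \<Rightarrow> ('v, 'e, 'x) lgraph \<Rightarrow> bool" where
  "is_cover X R C \<longleftrightarrow>
     labelled_graph X C \<and> (\<exists>S. subgroup S (gp X R) \<and> lgraph_isomorphic C (Cayley X R S))"


section \<open>Amalgams\<close>

text \<open>The factors are indexed by \<open>1\<close> and \<open>2\<close>; the values of \<open>X\<close>, \<open>R\<close> and \<open>\<phi>\<close> at other
  indices are irrelevant. The relators \<open>amalg_rels\<close> express \<open>\<phi> 1 a = \<phi> 2 a\<close> for all
  \<open>a\<close> in \<open>A\<close> and all words representing the two sides. As \<open>A\<close> is finitely generated, finitely
  many of them imply the others, so that the amalgam is finitely presented.\<close>

locale amalgam =
  fixes X :: "nat \<Rightarrow> 'x set"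
    and R :: "nat \<Rightarrow> 'x word set"
    and A :: "('a, 'm) monoid_scheme"
    and \<phi> :: "nat \<Rightarrow> 'a \<Rightarrow> 'x word set"
  assumes finite_gens: "i \<in> {1, 2} \<Longrightarrow> finite (X i)"
    and finite_rels: "i \<in> {1, 2} \<Longrightarrow> finite (R i)"
    and rels_words: "i \<in> {1, 2} \<Longrightarrow> R i \<subseteq> words (X i)"
    and disjoint_gens: "X 1 \<inter> X 2 = {}"
    and group_A: "group A"
    and fg_A: "finitely_generated A (carrier A)"
    and mono_emb: "i \<in> {1, 2} \<Longrightarrow> \<phi> i \<in> mon A (gp (X i) (R i))"
begin

definition amalg_gens :: "'x set" where
  "amalg_gens = X 1 \<union> X 2"

definition amalg_rels :: "'x word set" where
  "amalg_rels = R 1 \<union> R 2 \<union>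
     {u @ inv_word v | u v a. u \<in> words (X 1) \<and> v \<in> words (X 2) \<and> a \<in> carrier A \<and>
        elem (X 1) (R 1) u = \<phi> 1 a \<and> elem (X 2) (R 2) v = \<phi> 2 a}"

definition amalg :: "'x word set monoid" where
  "amalg = gp amalg_gens amalg_rels"

definition val :: "'x word \<Rightarrow> 'x word set" where
  "val w = elem amalg_gens amalg_rels w"

text \<open>The image of \<open>A\<close> in the amalgam.\<close>

definition amalgamated :: "'x word set set" where
  "amalgamated = {val u | u. u \<in> words (X 1) \<and> elem (X 1) (R 1) u \<in> \<phi> 1 ` carrier A}"

definition Cayley_amalg ::
  "'x word set set \<Rightarrow> ('x word set set, 'x word set set \<times> 'x letter, 'x) lgraph" where
  "Cayley_amalg S = Cayley amalg_gens amalg_rels S"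

definition Lab :: "('v, 'e, 'x) lgraph \<Rightarrow> 'v \<Rightarrow> 'x word set set" where
  "Lab \<Gamma> v = {val (plab \<Gamma> p) | p. path \<Gamma> v p v}"

definition G_based :: "('v, 'e, 'x) lgraph \<Rightarrow> bool" where
  "G_based \<Gamma> \<longleftrightarrow> (\<forall>u p v. path \<Gamma> u p v \<and> val (plab \<Gamma> p) = \<one>\<^bsub>amalg\<^esub> \<longrightarrow> u = v)"


subsection \<open>Normal paths and the normal core\<close>

text \<open>A nonempty word is over at most one of the disjoint alphabets \<open>X 1\<close> and \<open>X 2\<close>, so for the
  syllables below, which are nonempty, lying in different factors is a matter of the alphabet.
  The empty list of syllables is normal; it makes the trivial path normal.\<close>

definition different_factors :: "'x word \<Rightarrow> 'x word \<Rightarrow> bool" where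
  "different_factors g h \<longleftrightarrow>
     (\<exists>i\<in>{1, 2}. \<exists>j\<in>{1, 2}. i \<noteq> j \<and> g \<in> words (X i) \<and> h \<in> words (X j))"

definition normal_form :: "'x word list \<Rightarrow> bool" where
  "normal_form gs \<longleftrightarrow>
     (\<forall>g\<in>set gs. (\<exists>i\<in>{1, 2}. g \<in> words (X i)) \<and> val g \<noteq> \<one>\<^bsub>amalg\<^esub>) \<and>
     successively different_factors gs \<and>
     (length gs \<noteq> 1 \<longrightarrow> (\<forall>g\<in>set gs. val g \<notin> amalgamated))"

definition mono_decomposition ::
  "('v, 'e, 'x) lgraph \<Rightarrow> 'e list \<Rightarrow> 'e list list \<Rightarrow> bool" where
  "mono_decomposition \<Gamma> p ps \<longleftrightarrow>
     concat ps = p \<and>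
     (\<forall>q\<in>set ps. q \<noteq> [] \<and> (\<exists>i\<in>{1, 2}. plab \<Gamma> q \<in> words (X i))) \<and>
     successively (\<lambda>q q'. different_factors (plab \<Gamma> q) (plab \<Gamma> q')) ps"

definition normal_path :: "('v, 'e, 'x) lgraph \<Rightarrow> 'v \<Rightarrow> 'e list \<Rightarrow> 'v \<Rightarrow> bool" where
  "normal_path \<Gamma> u p v \<longleftrightarrow>
     path \<Gamma> u p v \<and> (\<exists>ps. mono_decomposition \<Gamma> p ps \<and> normal_form (map (plab \<Gamma>) ps))"

text \<open>The union of all normal paths closed at the basepoint. The trivial path at the basepoint
  is one of them, so the basepoint always belongs to the normal core.\<close>

definition normal_core ::
  "'x word set set \<Rightarrow> ('x word set set, 'x word set set \<times> 'x letter, 'x) lgraph" where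
  "normal_core H =
     (let \<Gamma> = Cayley_amalg H; v0 = H #>\<^bsub>amalg\<^esub> \<one>\<^bsub>amalg\<^esub>; N = {p. normal_path \<Gamma> v0 p v0} in
      \<lparr>dg = \<lparr>verts = (\<Union>p\<in>N. set (pre_digraph.awalk_verts (dg \<Gamma>) v0 p)),
             arcs = (\<Union>p\<in>N. set p \<union> inv_arc \<Gamma> ` set p),
             tail = tail (dg \<Gamma>),
             head = head (dg \<Gamma>)\<rparr>,
       inv_arc = inv_arc \<Gamma>,
       lab = lab \<Gamma>\<rparr>)"


subsection \<open>Reduced precovers\<close>

definition some_component :: "('v, 'e, 'x) lgraph \<Rightarrow> ('v, 'e, 'x) lgraph \<Rightarrow> bool" where
  "some_component \<Gamma> C \<longleftrightarrow> (\<exists>i\<in>{1, 2}. mono_component (X i) \<Gamma> C)"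

text \<open>A single vertex without edges has no monochromatic components and hence is a precover.\<close>

definition precover :: "('v, 'e, 'x) lgraph \<Rightarrow> 'v \<Rightarrow> bool" where
  "precover \<Gamma> v0 \<longleftrightarrow>
     labelled_graph amalg_gens \<Gamma> \<and> v0 \<in> lverts \<Gamma> \<and>
     Digraph_Component.connected (dg \<Gamma>) \<and> G_based \<Gamma> \<and>
     (\<forall>i\<in>{1, 2}. \<forall>C. mono_component (X i) \<Gamma> C \<longrightarrow> is_cover (X i) (R i) C)"

definition bichromatic :: "('v, 'e, 'x) lgraph \<Rightarrow> 'v \<Rightarrow> bool" where
  "bichromatic \<Gamma> v \<longleftrightarrow>
     v \<in> lverts \<Gamma> \<and>
     (\<forall>i\<in>{1, 2}. \<exists>e\<in>larcs \<Gamma>. tail (dg \<Gamma>) e = v \<and> lab \<Gamma> e \<in> letters (X i))"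

definition VB :: "('v, 'e, 'x) lgraph \<Rightarrow> ('v, 'e, 'x) lgraph \<Rightarrow> 'v set" where
  "VB \<Gamma> C = {v \<in> lverts C. bichromatic \<Gamma> v}"

definition A_orbit :: "('v, 'e, 'x) lgraph \<Rightarrow> 'v \<Rightarrow> 'v set" where
  "A_orbit C v = {u. \<exists>p. path C v p u \<and> val (plab C p) \<in> amalgamated}"

text \<open>In a precover with at least two components every \<open>VB \<Gamma> C\<close> is nonempty, and if (i) and (ii)
  hold for one \<open>\<theta>\<close> in it, then (i)--(iii) do not depend on the choice of \<open>\<theta>\<close>.\<close>

definition redundant :: "('v, 'e, 'x) lgraph \<Rightarrow> 'v \<Rightarrow> ('v, 'e, 'x) lgraph \<Rightarrow> bool" where
  "redundant \<Gamma> v0 C \<longleftrightarrow>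
     (\<Gamma> = C \<and> Lab C v0 = {\<one>\<^bsub>amalg\<^esub>}) \<or>
     ((\<exists>C1 C2. some_component \<Gamma> C1 \<and> some_component \<Gamma> C2 \<and> C1 \<noteq> C2) \<and>
      (\<exists>\<theta>\<in>VB \<Gamma> C.
         Lab C \<theta> \<subseteq> amalgamated \<and>
         VB \<Gamma> C = A_orbit C \<theta> \<and>
         (v0 \<notin> lverts C \<or> (v0 \<in> VB \<Gamma> C \<and> Lab C \<theta> = {\<one>\<^bsub>amalg\<^esub>}))))"

definition reduced_precover :: "('v, 'e, 'x) lgraph \<Rightarrow> 'v \<Rightarrow> bool" where
  "reduced_precover \<Gamma> v0 \<longleftrightarrow>
     precover \<Gamma> v0 \<and>
     (\<forall>C. some_component \<Gamma> C \<longrightarrow> \<not> redundant \<Gamma> v0 C) \<and>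
     (\<forall>i\<in>{1, 2}. \<forall>C. mono_component (X i) \<Gamma> C \<and> v0 \<in> lverts C \<and>
        Lab C v0 \<inter> amalgamated \<noteq> {\<one>\<^bsub>amalg\<^esub>} \<longrightarrow>
        (\<exists>j\<in>{1, 2}. j \<noteq> i \<and>
           (\<exists>D. mono_component (X j) \<Gamma> D \<and> v0 \<in> lverts D \<and>
              Lab C v0 \<inter> amalgamated = Lab D v0 \<inter> amalgamated)))"

end

end

theory Submission
  imports Defs
begin

text \<open>
  A normal path closed at the basepoint \<open>H\<close> of the Cayley graph is the reading from \<open>H\<close> of a normal
  word \<open>g\<^sub>1 \<dots> g\<^sub>n\<close> with value in \<open>H\<close>. Normality depends only on the factor and the value of each
  syllable. Hence, if \<open>u\<close> is the vertex at which the syllable \<open>g\<close> over \<open>X i\<close> is entered, and \<open>w\<close> and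
  \<open>l\<close> are any word and any letter over \<open>X i\<close>, then \<open>g\<close> may be replaced by \<open>w l l\<inverse> w\<inverse> g\<close>. The new
  path is still normal and closed, and it runs through the arc labelled \<open>l\<close> at \<open>u \<cdot> w\<close>. So the
  normal core contains, with one arc labelled over \<open>X i\<close>, the whole orbit of its initial vertex
  under the words over \<open>X i\<close> (\<open>syllable_component_in_core\<close>). Therefore its monochromatic components
  are such full orbits (\<open>core_component_eq\<close>). The orbit of \<open>u\<close> is isomorphic to the relative Cayley
  graph of the factor for the stabiliser of \<open>u\<close>, so it is a cover (\<open>is_cover_component\<close>), and the core
  is a precover. Each element of \<open>H\<close> has a normal form (\<open>normal_form_exists\<close>), whose reading is a
  closed path in the core; so the core has label group \<open>H\<close> (\<open>Lab_core\<close>).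

  No component is redundant (\<open>core_not_redundant\<close>). Some syllable \<open>g\<close> of a closed normal path is read
  inside the component, from \<open>s\<close> to \<open>t\<close>. Each of \<open>s\<close> and \<open>t\<close> is the basepoint or a place where the
  path changes colour, hence bichromatic. If the component is the whole core, there are no
  changes of colour, so \<open>g\<close> is a loop at the basepoint, and its value is a nontrivial element of the
  label group. If the component is redundant by way of a bichromatic vertex \<open>\<theta>\<close>, then \<open>s\<close> and \<open>t\<close>
  lie in the \<open>A\<close>-orbit of \<open>\<theta>\<close>; as the loops at \<open>\<theta>\<close> have values in \<open>A\<close>, so has \<open>g\<close>. By normality
  \<open>g\<close> is then the only syllable and \<open>s\<close> and \<open>t\<close> are the basepoint, in which case redundancy demands
  that all loops at \<open>\<theta>\<close>, and hence \<open>g\<close>, have value \<open>\<one>\<close>: a contradiction. The last condition for being reduced holds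
  because both components at the basepoint meet \<open>A\<close> in \<open>H \<inter> A\<close>, and a nontrivial element of \<open>H \<inter> A\<close>
  is a normal word over either alphabet (\<open>base_components\<close>).
\<close>

section \<open>Presented groups\<close>

text \<open>These rules would turn membership in \<open>words Y\<close> into a statement about letters, which the
  lemmas below, all phrased for words, could no longer match.\<close>

declare in_listsD [rule del] in_listsI [rule del]

lemma inv_letter_simps [simp]:
  "inv_letter (inv_letter l) = l" "inv_letter l \<in> letters Y \<longleftrightarrow> l \<in> letters Y"
  by (auto simp: inv_letter_def letters_def mem_Times_iff)

lemma inv_letter_neq: "inv_letter l \<noteq> l"
  by (auto simp: inv_letter_def prod_eq_iff)

lemma inv_word_simps [simp]:
  "inv_word [] = []" "inv_word (l # w) = inv_word w @ [inv_letter l]"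
  by (auto simp: inv_word_def)

lemma inv_word_inv_word [simp]: "inv_word (inv_word w) = w"
  by (simp add: inv_word_def rev_map[symmetric] comp_def)

lemma inv_word_in_words [simp]: "inv_word w \<in> words Y \<longleftrightarrow> w \<in> words Y"
  by (induction w) auto

lemma letters_mono: "Y \<subseteq> Z \<Longrightarrow> letters Y \<subseteq> letters Z"
  by (auto simp: letters_def)

lemma pres_eq_words: "pres_eq Y Q u v \<Longrightarrow> u \<in> words Y \<and> v \<in> words Y"
  by (induction rule: pres_eq.induct) auto

lemma pres_eq_context:
  assumes "pres_eq Y Q u v" "a \<in> words Y" "b \<in> words Y"
  shows "pres_eq Y Q (a @ u @ b) (a @ v @ b)"
  using assms
proof (induction rule: pres_eq.induct)
  case (cancel u v l)
  then show ?case using pres_eq.cancel[of "a @ u" Y "v @ b" l Q] by simp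
next
  case (relator u v r)
  then show ?case using pres_eq.relator[of "a @ u" Y "v @ b" r Q] by simp
next
  case (sym u v)
  show ?case by (rule pres_eq.sym[OF sym.IH[OF sym.prems]])
next
  case (trans u v w)
  show ?case by (rule pres_eq.trans[OF trans.IH(1)[OF trans.prems] trans.IH(2)[OF trans.prems]])
qed (simp add: pres_eq.refl)

lemma pres_eq_inverse: "w \<in> words Y \<Longrightarrow> pres_eq Y Q (w @ inv_word w) []"
proof (induction w)
  case (Cons l w)
  then have "pres_eq Y Q ([l] @ (w @ inv_word w) @ [inv_letter l]) ([l] @ [] @ [inv_letter l])"
    by (intro pres_eq_context) auto
  moreover have "pres_eq Y Q ([] @ [l, inv_letter l] @ []) ([] @ [])"
    using Cons.prems by (intro pres_eq.cancel) auto
  ultimately show ?case by (auto intro: pres_eq.trans)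
qed (auto intro: pres_eq.refl)

lemma equiv_pres_rel: "equiv (words Y) (pres_rel Y Q)"
  by (rule equivI)
    (auto simp: pres_rel_def refl_on_def sym_def trans_def
      dest: pres_eq_words intro: pres_eq.intros)

lemma elem_eq_iff:
  "u \<in> words Y \<Longrightarrow> v \<in> words Y \<Longrightarrow> elem Y Q u = elem Y Q v \<longleftrightarrow> pres_eq Y Q u v"
  unfolding elem_def using eq_equiv_class_iff[OF equiv_pres_rel, of u Y v Q]
  by (simp add: pres_rel_def)

lemma elem_eqI: "pres_eq Y Q u v \<Longrightarrow> elem Y Q u = elem Y Q v"
  using elem_eq_iff[of u Y v Q] pres_eq_words[of Y Q u v] by simp

lemma elem_in_carrier [simp]: "w \<in> words Y \<Longrightarrow> elem Y Q w \<in> carrier (gp Y Q)"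
  by (auto simp: gp_def elem_def intro: quotientI)

lemma carrier_gpE:
  assumes "x \<in> carrier (gp Y Q)"
  obtains w where "w \<in> words Y" "x = elem Y Q w"
  using assms by (auto simp: gp_def elem_def elim!: quotientE)

lemma one_gp: "\<one>\<^bsub>gp Y Q\<^esub> = elem Y Q []"
  by (simp add: gp_def)

lemma mult_elem:
  assumes "u \<in> words Y" "v \<in> words Y"
  shows "elem Y Q u \<otimes>\<^bsub>gp Y Q\<^esub> elem Y Q v = elem Y Q (u @ v)"
proof -
  have *: "elem Y Q (u' @ v') = elem Y Q (u @ v)" if "u' \<in> elem Y Q u" "v' \<in> elem Y Q v" for u' v'
  proof -
    have "pres_eq Y Q u u'" "pres_eq Y Q v v'"
      using that by (auto simp: elem_def pres_rel_def)
    then have "pres_eq Y Q ([] @ u @ v) ([] @ u' @ v)" "pres_eq Y Q (u' @ v @ []) (u' @ v' @ [])"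
      using assms by (blast intro: pres_eq_context dest: pres_eq_words)+
    then show ?thesis by (intro elem_eqI pres_eq.sym[of Y Q "u @ v"]) (auto intro: pres_eq.trans)
  qed
  have "u \<in> elem Y Q u" "v \<in> elem Y Q v"
    using assms by (auto simp: elem_def pres_rel_def intro: pres_eq.refl)
  moreover have "(\<Union>u'\<in>elem Y Q u. \<Union>v'\<in>elem Y Q v. elem Y Q (u' @ v')) =
      (\<Union>u'\<in>elem Y Q u. \<Union>v'\<in>elem Y Q v. elem Y Q (u @ v))"
    using * by simp
  ultimately have "(\<Union>u'\<in>elem Y Q u. \<Union>v'\<in>elem Y Q v. elem Y Q (u' @ v')) = elem Y Q (u @ v)"
    by auto
  then show ?thesis by (simp add: gp_def)
qed

lemma group_gp: "group (gp Y Q)"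
proof (rule groupI)
  fix x y assume "x \<in> carrier (gp Y Q)" "y \<in> carrier (gp Y Q)"
  then obtain u v where "u \<in> words Y" "x = elem Y Q u" "v \<in> words Y" "y = elem Y Q v"
    by (metis carrier_gpE)
  then show "x \<otimes>\<^bsub>gp Y Q\<^esub> y \<in> carrier (gp Y Q)" by (simp add: mult_elem)
next
  show "\<one>\<^bsub>gp Y Q\<^esub> \<in> carrier (gp Y Q)" by (simp add: one_gp)
next
  fix x y z
  assume "x \<in> carrier (gp Y Q)" "y \<in> carrier (gp Y Q)" "z \<in> carrier (gp Y Q)"
  then obtain u v w where "u \<in> words Y" "x = elem Y Q u" "v \<in> words Y" "y = elem Y Q v"
    "w \<in> words Y" "z = elem Y Q w" by (metis carrier_gpE)
  then show "x \<otimes>\<^bsub>gp Y Q\<^esub> y \<otimes>\<^bsub>gp Y Q\<^esub> z = x \<otimes>\<^bsub>gp Y Q\<^esub> (y \<otimes>\<^bsub>gp Y Q\<^esub> z)"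
    by (simp add: mult_elem)
next
  fix x assume "x \<in> carrier (gp Y Q)"
  then obtain w where w: "w \<in> words Y" "x = elem Y Q w" by (rule carrier_gpE)
  then show "\<one>\<^bsub>gp Y Q\<^esub> \<otimes>\<^bsub>gp Y Q\<^esub> x = x" by (simp add: one_gp mult_elem)
  have "elem Y Q (inv_word w) \<otimes>\<^bsub>gp Y Q\<^esub> x = elem Y Q (inv_word w @ inv_word (inv_word w))"
    using w by (simp add: mult_elem)
  also have "\<dots> = \<one>\<^bsub>gp Y Q\<^esub>"
    unfolding one_gp using w by (intro elem_eqI pres_eq_inverse) simp
  finally have "elem Y Q (inv_word w) \<otimes>\<^bsub>gp Y Q\<^esub> x = \<one>\<^bsub>gp Y Q\<^esub>" .
  moreover have "elem Y Q (inv_word w) \<in> carrier (gp Y Q)" using w by simp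
  ultimately show "\<exists>y\<in>carrier (gp Y Q). y \<otimes>\<^bsub>gp Y Q\<^esub> x = \<one>\<^bsub>gp Y Q\<^esub>" by blast
qed

lemma inv_elem:
  assumes "w \<in> words Y"
  shows "inv\<^bsub>gp Y Q\<^esub> elem Y Q w = elem Y Q (inv_word w)"
proof (rule group.inv_equality[OF group_gp])
  have "elem Y Q (inv_word w @ inv_word (inv_word w)) = \<one>\<^bsub>gp Y Q\<^esub>"
    unfolding one_gp using assms by (intro elem_eqI pres_eq_inverse) simp
  then show "elem Y Q (inv_word w) \<otimes>\<^bsub>gp Y Q\<^esub> elem Y Q w = \<one>\<^bsub>gp Y Q\<^esub>"
    using assms by (simp add: mult_elem)
qed (use assms in simp_all)


section \<open>Cayley graphs and their symmetric parts\<close>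

locale cayley_graph =
  fixes Y :: "'x set" and Q :: "'x word set" and S :: "'x word set set"
  assumes subgroup_S: "subgroup S (gp Y Q)"
begin

abbreviation P where "P \<equiv> gp Y Q"
abbreviation cosets where "cosets \<equiv> rcosets\<^bsub>P\<^esub> S"

definition act :: "'x word set set \<Rightarrow> 'x word \<Rightarrow> 'x word set set" where
  "act c w = c #>\<^bsub>P\<^esub> elem Y Q w"

lemma S_carrier: "S \<subseteq> carrier P"
  using subgroup_S by (rule subgroup.subset)

lemma coset_carrier: "c \<in> cosets \<Longrightarrow> c \<subseteq> carrier P"
  by (rule subgroup.rcosets_carrier[OF subgroup_S group_gp])

lemma act_Nil [simp]: "c \<in> cosets \<Longrightarrow> act c [] = c"
  using group.coset_mult_one[OF group_gp, OF coset_carrier, of c]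
  by (simp add: act_def one_gp)

lemma act_append:
  assumes "c \<in> cosets" "u \<in> words Y" "v \<in> words Y"
  shows "act c (u @ v) = act (act c u) v"
  using group.coset_mult_assoc[OF group_gp, OF coset_carrier, of c "elem Y Q u" "elem Y Q v"] assms
  by (simp add: act_def mult_elem)

lemma base_in_cosets [simp]: "S \<in> cosets"
proof -
  have "S #>\<^bsub>P\<^esub> \<one>\<^bsub>P\<^esub> \<in> cosets"
    using S_carrier by (intro group.rcosetsI group_gp) (simp_all add: one_gp)
  then show ?thesis using S_carrier by (simp add: group.coset_mult_one group_gp)
qed

lemma act_in_cosets [simp]:
  assumes "c \<in> cosets" "w \<in> words Y"
  shows "act c w \<in> cosets"
proof -
  obtain x where x: "x \<in> carrier P" "c = S #>\<^bsub>P\<^esub> x"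
    using assms(1) by (auto simp: RCOSETS_def)
  have "act c w = S #>\<^bsub>P\<^esub> (x \<otimes>\<^bsub>P\<^esub> elem Y Q w)"
    using group.coset_mult_assoc[OF group_gp S_carrier x(1), of "elem Y Q w"] assms(2) x(2)
    by (simp add: act_def)
  moreover have "x \<otimes>\<^bsub>P\<^esub> elem Y Q w \<in> carrier P"
    using x(1) assms(2) by (intro monoid.m_closed group.is_monoid group_gp) simp_all
  ultimately show ?thesis using S_carrier by (simp add: group.rcosetsI group_gp)
qed

lemma act_cong: "elem Y Q u = elem Y Q v \<Longrightarrow> act c u = act c v"
  by (simp add: act_def)

lemma act_inverse:
  assumes "c \<in> cosets" "w \<in> words Y"
  shows "act (act c w) (inv_word w) = c"
proof -
  have "act (act c w) (inv_word w) = act c (w @ inv_word w)" using assms by (simp add: act_append)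
  also have "\<dots> = act c []" using assms by (intro act_cong elem_eqI pres_eq_inverse)
  finally show ?thesis using assms by simp
qed

lemma act_inv_letter [simp]:
  "c \<in> cosets \<Longrightarrow> l \<in> letters Y \<Longrightarrow> act (act c [l]) [inv_letter l] = c"
  using act_inverse[of c "[l]"] by simp

lemma act_base_iff:
  assumes "w \<in> words Y"
  shows "act S w = S \<longleftrightarrow> elem Y Q w \<in> S"
  using assms group.coset_join1[OF group_gp _ _ subgroup_S, of "elem Y Q w"]
    group.coset_join2[OF group_gp _ subgroup_S, of "elem Y Q w"] S_carrier
  by (auto simp: act_def)

text \<open>The path that reads a word from a given vertex; every path has this form.\<close>

primrec read :: "'x word set set \<Rightarrow> 'x word \<Rightarrow> ('x word set set \<times> 'x letter) list" where
  "read c [] = []"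
| "read c (l # w) = (c, l) # read (act c [l]) w"

lemma map_snd_read [simp]: "map snd (read c w) = w"
  by (induction w arbitrary: c) auto

lemma read_append:
  "c \<in> cosets \<Longrightarrow> u \<in> words Y \<Longrightarrow> v \<in> words Y \<Longrightarrow> read c (u @ v) = read c u @ read (act c u) v"
proof (induction u arbitrary: c)
  case (Cons l u)
  then show ?case using act_append[of c "[l]" u] by simp
qed simp

lemma mem_read_iff:
  assumes "c \<in> cosets" "w \<in> words Y"
  shows "e \<in> set (read c w) \<longleftrightarrow> (\<exists>a l b. w = a @ l # b \<and> e = (act c a, l))"
proof
  assume "e \<in> set (read c w)"
  then show "\<exists>a l b. w = a @ l # b \<and> e = (act c a, l)"
    using assms
  proof (induction w arbitrary: c)
    case (Cons l w)
    show ?case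
    proof (cases "e = (c, l)")
      case True
      then have "l # w = [] @ l # w \<and> e = (act c [], l)" using Cons.prems by simp
      then show ?thesis by blast
    next
      case False
      then obtain a m b where "w = a @ m # b" "e = (act (act c [l]) a, m)"
        using Cons.IH[of "act c [l]"] Cons.prems by auto
      then have "l # w = (l # a) @ m # b \<and> e = (act c (l # a), m)"
        using Cons.prems act_append[of c "[l]" a] by simp
      then show ?thesis by blast
    qed
  qed simp
next
  assume "\<exists>a l b. w = a @ l # b \<and> e = (act c a, l)"
  then obtain a l b where "w = a @ l # b" "e = (act c a, l)" by blast
  then show "e \<in> set (read c w)" using assms by (simp add: read_append)
qed

text \<open>The subgraph of the Cayley graph with vertices \<open>V\<close> and arcs \<open>E\<close>. The normal core and all its
  components have this form; the condition \<open>symmetric_part\<close> below says when it is a subgraph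
  in the sense of labelled graphs.\<close>

definition part :: "'x word set set set \<Rightarrow> ('x word set set \<times> 'x letter) set \<Rightarrow>
    ('x word set set, 'x word set set \<times> 'x letter, 'x) lgraph" where
  "part V E = \<lparr>dg = \<lparr>verts = V, arcs = E, tail = fst, head = (\<lambda>(c, l). act c [l])\<rparr>,
     inv_arc = (\<lambda>e. ((\<lambda>(c, l). act c [l]) e, inv_letter (snd e))), lab = snd\<rparr>"

lemma part_simps [simp]:
  "lverts (part V E) = V" "larcs (part V E) = E"
  "tail (dg (part V E)) = fst" "head (dg (part V E)) e = act (fst e) [snd e]"
  "inv_arc (part V E) e = (act (fst e) [snd e], inv_letter (snd e))" "lab (part V E) = snd"
  by (auto simp: part_def case_prod_beta)

lemma head_part: "head (dg (part V E)) = head (dg (part V' E'))"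
  by (simp add: part_def)

lemma inv_arc_part: "inv_arc (part V E) = inv_arc (part V' E')"
  by (simp add: part_def)

lemma Cayley_eq_part: "Cayley Y Q S = part cosets (cosets \<times> letters Y)"
  by (simp add: Cayley_def part_def act_def Let_def)

definition symmetric_part :: "'x word set set set \<Rightarrow> ('x word set set \<times> 'x letter) set \<Rightarrow> bool" where
  "symmetric_part V E \<longleftrightarrow> V \<subseteq> cosets \<and> E \<subseteq> V \<times> letters Y \<and>
     (\<forall>(c, l)\<in>E. (act c [l], inv_letter l) \<in> E)"

lemma symmetric_part_verts: "symmetric_part V E \<Longrightarrow> c \<in> V \<Longrightarrow> c \<in> cosets"
  by (auto simp: symmetric_part_def)

lemma symmetric_part_arc:
  assumes "symmetric_part V E" "(c, l) \<in> E"
  shows "c \<in> V" "c \<in> cosets" "l \<in> letters Y" "act c [l] \<in> V"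
    and "(act c [l], inv_letter l) \<in> E"
proof -
  show *: "(act c [l], inv_letter l) \<in> E"
    using assms unfolding symmetric_part_def by (auto dest!: bspec)
  show "c \<in> V" "c \<in> cosets" "l \<in> letters Y" "act c [l] \<in> V"
    using assms * unfolding symmetric_part_def by auto
qed

lemma symmetric_part_wf:
  assumes "symmetric_part V E"
  shows "wf_digraph (dg (part V E))"
proof
  fix e assume "e \<in> larcs (part V E)"
  then show "tail (dg (part V E)) e \<in> lverts (part V E)" "head (dg (part V E)) e \<in> lverts (part V E)"
    using symmetric_part_arc[OF assms, of "fst e" "snd e"] by auto
qed

lemma symmetric_part_labelled_graph:
  assumes "symmetric_part V E" "snd ` E \<subseteq> letters Z"
  shows "labelled_graph Z (part V E)"
  unfolding labelled_graph_def
proof (intro conjI wf_digraph.bidirected_digraphI symmetric_part_wf[OF assms(1)])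
  show "\<forall>e\<in>larcs (part V E). lab (part V E) e \<in> letters Z \<and>
      lab (part V E) (inv_arc (part V E) e) = inv_letter (lab (part V E) e)"
    using assms(2) by auto
next
  let ?r = "perm_restrict (inv_arc (part V E)) (larcs (part V E))"
  fix e assume e: "e \<in> larcs (part V E)"
  obtain c l where [simp]: "e = (c, l)" by (cases e)
  note D = symmetric_part_arc[OF assms(1), of c l]
  have *: "?r e = (act c [l], inv_letter l)" using e by (simp add: perm_restrict_def)
  show "?r e \<noteq> e" using * inv_letter_neq[of l] by simp
  show "tail (dg (part V E)) (?r e) = head (dg (part V E)) e" using * by simp
  show "?r (?r e) = e" unfolding * using e D by (simp add: perm_restrict_def)
qed (simp add: perm_restrict_def)

lemma sub_lgraph_part:
  assumes "symmetric_part V E" "symmetric_part V' E'" "V \<subseteq> V'" "E \<subseteq> E'"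
  shows "sub_lgraph (part V E) (part V' E')"
proof -
  have "inv_arc (part V' E') ` E \<subseteq> E"
    using symmetric_part_arc(5)[OF assms(1)] by auto
  then show ?thesis
    using assms symmetric_part_wf head_part[of V E V' E'] inv_arc_part[of V E V' E']
    by (simp add: sub_lgraph_def subgraph_def compatible_def)
qed

text \<open>Compatibility of subgraphs is equality of the structure maps, even outside the arcs, so a
  subgraph of a part is again literally a part.\<close>

lemma sub_lgraph_of_partE:
  assumes "sub_lgraph C (part V E)" "symmetric_part V E"
  obtains V' E' where "C = part V' E'" "symmetric_part V' E'" "V' \<subseteq> V" "E' \<subseteq> E"
proof
  have wf: "wf_digraph (dg C)" and sub: "lverts C \<subseteq> V" "larcs C \<subseteq> E"
    and eqs: "tail (dg C) = fst" "head (dg C) = head (dg (part V E))"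
      "inv_arc C = inv_arc (part V E)" "lab C = snd"
    and closed: "inv_arc (part V E) ` larcs C \<subseteq> larcs C"
    using assms by (auto simp: sub_lgraph_def subgraph_def compatible_def)
  show "C = part (lverts C) (larcs C)"
    using eqs by (simp add: part_def)
  show "lverts C \<subseteq> V" "larcs C \<subseteq> E" using sub by auto
  show "symmetric_part (lverts C) (larcs C)"
    unfolding symmetric_part_def
  proof (intro conjI subsetI ballI)
    fix c assume "c \<in> lverts C"
    then show "c \<in> cosets" using sub symmetric_part_verts[OF assms(2)] by blast
  next
    fix e assume e: "e \<in> larcs C"
    then show "case e of (c, l) \<Rightarrow> (act c [l], inv_letter l) \<in> larcs C"
      using closed by (force simp: case_prod_beta)
    show "e \<in> lverts C \<times> letters Y"
      using e sub symmetric_part_arc(3)[OF assms(2), of "fst e" "snd e"]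
        wf_digraph.tail_in_verts[OF wf e] eqs(1) by (auto simp: mem_Times_iff)
  qed
qed

lemma path_part_iff:
  assumes "symmetric_part V E"
  shows "path (part V E) u p v \<longleftrightarrow>
    u \<in> V \<and> set p \<subseteq> E \<and> p = read u (map snd p) \<and> map snd p \<in> words Y \<and> v = act u (map snd p)"
proof -
  have cas: "pre_digraph.cas (dg (part V E)) u p v \<longleftrightarrow>
    p = read u (map snd p) \<and> v = act u (map snd p)"
    if "u \<in> cosets" "map snd p \<in> words Y"
    using that
  proof (induction p arbitrary: u)
    case (Cons e p)
    then show ?case
      using act_append[of u "[snd e]" "map snd p"]
      by (cases e) (auto simp: pre_digraph.cas.simps)
  qed (auto simp: pre_digraph.cas.simps)
  have words: "map snd p \<in> words Y" if "set p \<subseteq> E"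
    using that symmetric_part_arc(3)[OF assms] by (intro in_listsI) force
  show ?thesis
    using cas words symmetric_part_verts[OF assms] by (auto simp: pre_digraph.awalk_def)
qed

lemma connected_part:
  assumes sym: "symmetric_part V E" and "v0 \<in> V"
    and reach: "\<And>v. v \<in> V \<Longrightarrow> \<exists>p. path (part V E) v0 p v"
  shows "Digraph_Component.connected (dg (part V E))"
proof -
  interpret D: wf_digraph "dg (part V E)" using sym by (rule symmetric_part_wf)
  let ?M = "mk_symmetric (dg (part V E))"
  interpret M: pair_wf_digraph ?M by (rule D.wellformed_mk_symmetric)
  have from_v0: "v0 \<rightarrow>\<^sup>*\<^bsub>with_proj ?M\<^esub> v" if "v \<in> V" for v
    using reach[OF that] by (auto intro: D.reachable_mk_symmetricI D.reachable_awalkI)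
  have to_v0: "v \<rightarrow>\<^sup>*\<^bsub>with_proj ?M\<^esub> v0" if "v \<in> V" for v
  proof -
    have "sym (rtrancl_on V (parcs ?M))"
      by (intro rtrancl_on_sym) (auto simp: sym_def parcs_mk_symmetric)
    then show ?thesis using from_v0[OF that] by (auto simp: reachable_def dest: symD)
  qed
  show ?thesis
    unfolding connected_def
  proof (rule strongly_connectedI)
    fix u v assume "u \<in> verts (with_proj ?M)" "v \<in> verts (with_proj ?M)"
    then have "u \<rightarrow>\<^sup>*\<^bsub>with_proj ?M\<^esub> v0" "v0 \<rightarrow>\<^sup>*\<^bsub>with_proj ?M\<^esub> v"
      using to_v0 from_v0 by auto
    then show "u \<rightarrow>\<^sup>*\<^bsub>with_proj ?M\<^esub> v" by (rule M.reachable_trans)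
  qed (use assms(2) in auto)
qed

text \<open>Induction over the vertices of a connected part, in the form: a set of vertices that no arc
  enters or leaves contains all of them as soon as it contains one.\<close>

lemma connected_part_reach:
  assumes conn: "Digraph_Component.connected (dg (part V E))"
    and "u \<in> V" "v \<in> V" "u \<in> W"
    and closed: "\<And>c l. (c, l) \<in> E \<Longrightarrow> c \<in> W \<longleftrightarrow> act c [l] \<in> W"
  shows "v \<in> W"
proof -
  have "u \<rightarrow>\<^sup>*\<^bsub>with_proj (mk_symmetric (dg (part V E)))\<^esub> v"
    using assms(1-3) by (simp add: connected_def strongly_connected_def)
  then have "(u, v) \<in> rtrancl_on V (parcs (mk_symmetric (dg (part V E))))"
    by (simp add: reachable_def)
  then show ?thesis
    using \<open>u \<in> W\<close> closed by induction (auto simp: parcs_mk_symmetric)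
qed

end


section \<open>Monochromatic components of parts of Cayley graphs\<close>

lemma words_mono: "Z \<subseteq> Y \<Longrightarrow> words Z \<subseteq> words Y"
  by (intro lists_mono letters_mono)

context cayley_graph
begin

definition component_verts :: "'x set \<Rightarrow> 'x word set set \<Rightarrow> 'x word set set set" where
  "component_verts Z u = act u ` words Z"

text \<open>The orbit of \<open>u\<close> under the words over the alphabet \<open>Z\<close>, with all arcs labelled over \<open>Z\<close>: the
  component of \<open>u\<close> over \<open>Z\<close> in the full Cayley graph.\<close>

definition component :: "'x set \<Rightarrow> 'x word set set \<Rightarrow>
    ('x word set set, 'x word set set \<times> 'x letter, 'x) lgraph" where
  "component Z u = part (component_verts Z u) (component_verts Z u \<times> letters Z)"

lemma component_vertsI [intro]: "w \<in> words Z \<Longrightarrow> act u w \<in> component_verts Z u"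
  by (auto simp: component_verts_def)

lemma self_in_component_verts [simp]: "u \<in> cosets \<Longrightarrow> u \<in> component_verts Z u"
  using component_vertsI[of "[]" Z u] by simp

lemma component_verts_cosets: "Z \<subseteq> Y \<Longrightarrow> u \<in> cosets \<Longrightarrow> component_verts Z u \<subseteq> cosets"
  using words_mono[of Z Y] by (auto simp: component_verts_def)

lemma component_verts_act:
  assumes "Z \<subseteq> Y" "u \<in> cosets" "w \<in> words Z"
  shows "v \<in> component_verts Z u \<Longrightarrow> act v w \<in> component_verts Z u"
proof -
  assume "v \<in> component_verts Z u"
  then obtain x where x: "x \<in> words Z" "v = act u x" by (auto simp: component_verts_def)
  then have "act v w = act u (x @ w)" using assms words_mono[of Z Y] by (subst act_append) auto
  then show ?thesis using x assms by auto
qed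

lemma component_verts_sym:
  assumes "Z \<subseteq> Y" "u \<in> cosets" "v \<in> component_verts Z u"
  shows "u \<in> component_verts Z v"
proof -
  obtain w where w: "w \<in> words Z" "v = act u w" using assms by (auto simp: component_verts_def)
  then have "u = act v (inv_word w)" using act_inverse[of u w] words_mono[of Z Y] assms by auto
  then show ?thesis using w component_vertsI[of "inv_word w" Z v] by simp
qed

lemma component_verts_eq:
  assumes "Z \<subseteq> Y" "u \<in> cosets" "v \<in> component_verts Z u"
  shows "component_verts Z v = component_verts Z u"
proof -
  have sub: "component_verts Z b \<subseteq> component_verts Z a" if "a \<in> cosets" "b \<in> component_verts Z a" for a b
    using component_verts_act[OF assms(1) that(1) _ that(2)] by (auto simp: component_verts_def[of Z b])
  have "v \<in> cosets" using component_verts_cosets[OF assms(1,2)] assms(3) by blast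
  then show ?thesis
    using sub[OF assms(2,3)] sub[of v u] component_verts_sym[OF assms] by blast
qed

lemma component_eq: "Z \<subseteq> Y \<Longrightarrow> u \<in> cosets \<Longrightarrow> v \<in> component_verts Z u \<Longrightarrow> component Z v = component Z u"
  using component_verts_eq[of Z u v] by (simp add: component_def)

lemma symmetric_part_component:
  assumes "Z \<subseteq> Y" "u \<in> cosets"
  shows "symmetric_part (component_verts Z u) (component_verts Z u \<times> letters Z)"
  unfolding symmetric_part_def
  using component_verts_cosets[OF assms] component_verts_act[OF assms, of "[_]"] letters_mono[OF assms(1)]
  by auto

lemma set_read_subset_component:
  assumes "Z \<subseteq> Y" "u \<in> cosets" "v \<in> component_verts Z u" "w \<in> words Z"
  shows "set (read v w) \<subseteq> component_verts Z u \<times> letters Z"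
  using assms(3,4)
proof (induction w arbitrary: v)
  case (Cons l w)
  then show ?case using component_verts_act[OF assms(1,2), of "[l]" v] by auto
qed simp

lemma path_component_iff:
  assumes "Z \<subseteq> Y" "u \<in> cosets" "v \<in> component_verts Z u"
  shows "path (component Z u) v p v' \<longleftrightarrow> (\<exists>w\<in>words Z. p = read v w \<and> v' = act v w)"
proof
  assume "path (component Z u) v p v'"
  then have p: "set p \<subseteq> component_verts Z u \<times> letters Z" "p = read v (map snd p)" "v' = act v (map snd p)"
    unfolding component_def path_part_iff[OF symmetric_part_component[OF assms(1,2)]] by auto
  moreover have "map snd p \<in> words Z" using p(1) by (intro in_listsI) auto
  ultimately show "\<exists>w\<in>words Z. p = read v w \<and> v' = act v w" by blast
next
  assume "\<exists>w\<in>words Z. p = read v w \<and> v' = act v w"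
  then show "path (component Z u) v p v'"
    unfolding component_def path_part_iff[OF symmetric_part_component[OF assms(1,2)]]
    using assms set_read_subset_component[OF assms] words_mono[OF assms(1)] by auto
qed

lemma connected_component:
  assumes "Z \<subseteq> Y" "u \<in> cosets"
  shows "Digraph_Component.connected (dg (component Z u))"
  unfolding component_def
proof (rule connected_part[OF symmetric_part_component[OF assms]])
  show "u \<in> component_verts Z u" using assms by simp
next
  fix v assume "v \<in> component_verts Z u"
  then obtain w where "w \<in> words Z" "v = act u w" by (auto simp: component_verts_def)
  then have "path (component Z u) u (read u w) v"
    using path_component_iff[OF assms self_in_component_verts[OF assms(2)]] by blast
  then show "\<exists>p. path (part (component_verts Z u) (component_verts Z u \<times> letters Z)) u p v"
    unfolding component_def by blast
qed

text \<open>The arcs of a monochromatic subgraph do not leave the orbit of \<open>u\<close>, and the subgraph is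
  connected.\<close>

lemma mono_subgraph_subset_component:
  assumes mono: "mono_subgraph Z (part V E) C" and sym: "symmetric_part V E"
    and Z: "Z \<subseteq> Y" and u: "u \<in> lverts C"
  shows "sub_lgraph C (component Z u)"
proof -
  obtain V' E' where C: "C = part V' E'" "symmetric_part V' E'" "V' \<subseteq> V" "E' \<subseteq> E"
    using mono sym unfolding mono_subgraph_def by (metis sub_lgraph_of_partE)
  have cos: "c \<in> cosets" if "c \<in> V'" for c using that symmetric_part_verts[OF C(2)] by blast
  have E'_Z: "l \<in> letters Z" if "(c, l) \<in> E'" for c l
    using mono that unfolding mono_subgraph_def C(1) by auto
  have u': "u \<in> V'" "u \<in> cosets" using u cos unfolding C(1) by auto
  have V': "v \<in> component_verts Z u" if "v \<in> V'" for v
  proof (rule connected_part_reach[of V' E'])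
    show "Digraph_Component.connected (dg (part V' E'))"
      using mono unfolding mono_subgraph_def C(1) by blast
    fix c l assume cl: "(c, l) \<in> E'"
    note a = symmetric_part_arc[OF C(2) cl]
    show "c \<in> component_verts Z u \<longleftrightarrow> act c [l] \<in> component_verts Z u"
      using component_verts_act[OF Z u'(2), of "[l]" c] component_verts_act[OF Z u'(2), of "[inv_letter l]" "act c [l]"]
        E'_Z[OF cl] a by auto
  qed (use u' that in auto)
  then have "E' \<subseteq> component_verts Z u \<times> letters Z"
    using E'_Z symmetric_part_arc(1)[OF C(2)] by auto
  then show ?thesis
    unfolding C(1) component_def
    using V' by (intro sub_lgraph_part C(2) symmetric_part_component Z u'(2)) auto
qed

text \<open>For a symmetric part with saturated arcs, the components over \<open>Z\<close> are whole orbits. The core is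
  saturated because syllables can be replaced.\<close>

definition saturated :: "'x set \<Rightarrow> ('x word set set \<times> 'x letter) set \<Rightarrow> bool" where
  "saturated Z E \<longleftrightarrow> (\<forall>c l. (c, l) \<in> E \<and> l \<in> letters Z \<longrightarrow> component_verts Z c \<times> letters Z \<subseteq> E)"

lemma saturated_mono_subgraph:
  assumes sat: "saturated Z E" and sym: "symmetric_part V E" and Z: "Z \<subseteq> Y"
    and cl: "(c, l) \<in> E" "l \<in> letters Z"
  shows "mono_subgraph Z (part V E) (component Z c)"
proof -
  have c: "c \<in> cosets" using symmetric_part_arc[OF sym cl(1)] by blast
  have E: "component_verts Z c \<times> letters Z \<subseteq> E" using sat cl unfolding saturated_def by blast
  moreover from this have "component_verts Z c \<subseteq> V"
    using cl(2) symmetric_part_arc(1)[OF sym] by blast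
  ultimately have "sub_lgraph (component Z c) (part V E)"
    unfolding component_def by (intro sub_lgraph_part symmetric_part_component Z c sym)
  moreover have "larcs (component Z c) \<noteq> {}" using c cl(2) self_in_component_verts by (auto simp: component_def)
  ultimately show ?thesis
    unfolding mono_subgraph_def using connected_component[OF Z c] by (auto simp: component_def)
qed

lemma sub_lgraph_antisym:
  assumes "sub_lgraph C D" "sub_lgraph D C"
  shows "C = D"
  using assms by (intro lgraph.equality pre_digraph.equality)
    (auto simp: sub_lgraph_def subgraph_def compatible_def)

lemma saturated_mono_component_eq:
  assumes sat: "saturated Z E" and sym: "symmetric_part V E" and Z: "Z \<subseteq> Y"
    and C: "mono_component Z (part V E) C" and u: "u \<in> lverts C"
  shows "C = component Z u" "u \<in> V" "\<exists>l\<in>letters Z. (u, l) \<in> E"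
proof -
  have mono: "mono_subgraph Z (part V E) C"
    and max: "\<And>C'. mono_subgraph Z (part V E) C' \<Longrightarrow> sub_lgraph C C' \<Longrightarrow> C' = C"
    using C unfolding mono_component_def by blast+
  have "larcs C \<noteq> {}" and sub: "sub_lgraph C (part V E)" using mono unfolding mono_subgraph_def by auto
  then obtain c l where cl: "(c, l) \<in> larcs C" by fastforce
  have "lverts C \<subseteq> V" "larcs C \<subseteq> E" "wf_digraph (dg C)" "tail (dg C) = fst" "lab C = snd"
    using sub by (auto simp: sub_lgraph_def subgraph_def compatible_def)
  then have *: "(c, l) \<in> E" "c \<in> lverts C" "l \<in> letters Z" "u \<in> V"
    using cl u wf_digraph.tail_in_verts[of "dg C" "(c, l)"] mono by (auto simp: mono_subgraph_def)
  have "component Z c = C"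
    using max saturated_mono_subgraph[OF sat sym Z *(1,3)]
      mono_subgraph_subset_component[OF mono sym Z *(2)] by blast
  moreover have "c \<in> cosets" using symmetric_part_arc(2)[OF sym *(1)] .
  moreover have u_c: "u \<in> component_verts Z c" using u \<open>component Z c = C\<close> by (auto simp: component_def)
  ultimately show "C = component Z u" using component_eq[OF Z, of c u] by simp
  show "u \<in> V" by fact
  show "\<exists>l\<in>letters Z. (u, l) \<in> E" using sat * u_c unfolding saturated_def by blast
qed

lemma saturated_mono_component:
  assumes sat: "saturated Z E" and sym: "symmetric_part V E" and Z: "Z \<subseteq> Y"
    and cl: "(c, l) \<in> E" "l \<in> letters Z"
  shows "mono_component Z (part V E) (component Z c)"
proof -
  have c: "c \<in> cosets" using symmetric_part_arc[OF sym cl(1)] by blast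
  have "C' = component Z c" if "mono_subgraph Z (part V E) C'" "sub_lgraph (component Z c) C'" for C'
  proof (rule sub_lgraph_antisym[OF mono_subgraph_subset_component[OF that(1) sym Z] that(2)])
    show "c \<in> lverts C'" using that(2) c by (auto simp: sub_lgraph_def subgraph_def component_def)
  qed
  then show ?thesis
    unfolding mono_component_def using saturated_mono_subgraph[OF assms] by blast
qed

text \<open>Let \<open>T\<close> be the stabiliser of \<open>u\<close> in the group presented by \<open>Z\<close> and \<open>QZ\<close>. An isomorphism sends
  a vertex \<open>c\<close> to the set of all group elements carrying \<open>u\<close> to \<open>c\<close>, which is a right coset of
  \<open>T\<close>. The hypothesis \<open>hom\<close> makes the action of this group on the orbit well defined.\<close>

lemma is_cover_component:
  assumes Z: "Z \<subseteq> Y" and u: "u \<in> cosets"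
    and hom: "\<And>v w. elem Z QZ v = elem Z QZ w \<Longrightarrow> v \<in> words Z \<Longrightarrow> w \<in> words Z \<Longrightarrow>
      elem Y Q v = elem Y Q w"
  shows "is_cover Z QZ (component Z u)"
proof -
  define f where "f c = {elem Z QZ w | w. w \<in> words Z \<and> act u w = c}" for c
  define T where "T = f u"
  have YZ: "w \<in> words Y" if "w \<in> words Z" for w using that words_mono[OF Z] by blast
  have subgroup_T: "subgroup T (gp Z QZ)"
  proof (rule group.subgroupI[OF group_gp])
    show "T \<subseteq> carrier (gp Z QZ)" by (auto simp: T_def f_def)
    have "elem Z QZ [] \<in> T" using u by (auto simp: T_def f_def intro!: exI[of _ "[]"])
    then show "T \<noteq> {}" by blast
  next
    fix x assume "x \<in> T"
    then obtain w where w: "x = elem Z QZ w" "w \<in> words Z" "act u w = u"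
      by (auto simp: T_def f_def)
    have "act u (inv_word w) = u" using act_inverse[of u w] w YZ u by simp
    then show "inv\<^bsub>gp Z QZ\<^esub> x \<in> T"
      using w by (auto simp: T_def f_def inv_elem intro!: exI[of _ "inv_word w"])
  next
    fix x y assume "x \<in> T" "y \<in> T"
    then obtain v w where "x = elem Z QZ v" "v \<in> words Z" "act u v = u"
        "y = elem Z QZ w" "w \<in> words Z" "act u w = u"
      by (auto simp: T_def f_def)
    then show "x \<otimes>\<^bsub>gp Z QZ\<^esub> y \<in> T"
      using u YZ by (auto simp: T_def f_def mult_elem act_append intro!: exI[of _ "v @ w"])
  qed
  have f_act: "f (act u w) = T #>\<^bsub>gp Z QZ\<^esub> elem Z QZ w" if w: "w \<in> words Z" for w
  proof (intro subset_antisym subsetI)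
    fix x assume "x \<in> f (act u w)"
    then obtain v where v: "x = elem Z QZ v" "v \<in> words Z" "act u v = act u w"
      by (auto simp: f_def)
    have "act u (v @ inv_word w) = u" using act_inverse[of u w] v w YZ u by (simp add: act_append)
    then have "elem Z QZ (v @ inv_word w) \<in> T" using v w by (auto simp: T_def f_def)
    moreover have "elem Z QZ (v @ inv_word w) \<otimes>\<^bsub>gp Z QZ\<^esub> elem Z QZ w = x"
    proof -
      have "pres_eq Z QZ (v @ (inv_word w @ inv_word (inv_word w)) @ []) (v @ [] @ [])"
        using v w by (intro pres_eq_context pres_eq_inverse) auto
      then show ?thesis using v w by (auto simp: mult_elem dest: elem_eqI)
    qed
    ultimately show "x \<in> T #>\<^bsub>gp Z QZ\<^esub> elem Z QZ w" unfolding r_coset_def by blast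
  next
    fix x assume "x \<in> T #>\<^bsub>gp Z QZ\<^esub> elem Z QZ w"
    then obtain v where v: "v \<in> words Z" "act u v = u" "x = elem Z QZ v \<otimes>\<^bsub>gp Z QZ\<^esub> elem Z QZ w"
      by (auto simp: T_def f_def r_coset_def)
    then have "x = elem Z QZ (v @ w)" "act u (v @ w) = act u w"
      using w YZ u by (simp_all add: mult_elem act_append)
    then show "x \<in> f (act u w)" using v w unfolding f_def by (auto intro!: exI[of _ "v @ w"])
  qed
  have f_head: "f (act c [l]) = f c #>\<^bsub>gp Z QZ\<^esub> elem Z QZ [l]"
    if c: "c \<in> component_verts Z u" and l: "l \<in> letters Z" for c l
  proof -
    obtain w where w: "w \<in> words Z" "c = act u w" using c by (auto simp: component_verts_def)
    have "f (act c [l]) = f (act u (w @ [l]))" using w l u YZ[of w] YZ[of "[l]"] by (simp add: act_append)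
    also have "\<dots> = T #>\<^bsub>gp Z QZ\<^esub> elem Z QZ (w @ [l])" using w l by (intro f_act) simp
    also have "\<dots> = f c #>\<^bsub>gp Z QZ\<^esub> elem Z QZ [l]"
      using group.coset_mult_assoc[OF group_gp subgroup.subset[OF subgroup_T], of "elem Z QZ w" "elem Z QZ [l]"]
        w l f_act[OF w(1)] by (simp add: mult_elem)
    finally show ?thesis .
  qed
  have bij_f: "bij_betw f (component_verts Z u) (rcosets\<^bsub>gp Z QZ\<^esub> T)"
    unfolding bij_betw_def
  proof
    show "inj_on f (component_verts Z u)"
    proof (rule inj_onI)
      fix c d assume "c \<in> component_verts Z u" "f c = f d"
      then obtain w where w: "w \<in> words Z" "c = act u w" by (auto simp: component_verts_def)
      then have "elem Z QZ w \<in> f d" using \<open>f c = f d\<close> by (auto simp: f_def)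
      then obtain v where "v \<in> words Z" "elem Z QZ w = elem Z QZ v" "act u v = d"
        by (auto simp: f_def)
      then show "c = d" using w hom[of w v] act_cong[of w v u] by simp
    qed
    show "f ` component_verts Z u = rcosets\<^bsub>gp Z QZ\<^esub> T"
    proof (intro subset_antisym subsetI)
      fix x assume "x \<in> f ` component_verts Z u"
      then show "x \<in> rcosets\<^bsub>gp Z QZ\<^esub> T" by (auto simp: component_verts_def f_act RCOSETS_def)
    next
      fix x assume "x \<in> rcosets\<^bsub>gp Z QZ\<^esub> T"
      then obtain w where "w \<in> words Z" "x = T #>\<^bsub>gp Z QZ\<^esub> elem Z QZ w"
        by (auto simp: RCOSETS_def elim: carrier_gpE)
      then show "x \<in> f ` component_verts Z u" using f_act[of w] by (metis component_vertsI imageI)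
    qed
  qed
  interpret T: cayley_graph Z QZ T by (rule cayley_graph.intro[OF subgroup_T])
  have "lgraph_isomorphic (component Z u) (Cayley Z QZ T)"
    unfolding lgraph_isomorphic_def T.Cayley_eq_part component_def
    by (intro exI[of _ f] exI[of _ "map_prod f id"])
      (auto simp: bij_f f_head T.act_def intro!: bij_betw_map_prod)
  moreover have "labelled_graph Z (component Z u)"
    unfolding component_def by (intro symmetric_part_labelled_graph symmetric_part_component Z u) auto
  ultimately show ?thesis unfolding is_cover_def using subgroup_T by blast
qed

end


section \<open>Normal forms in an amalgam\<close>

lemma not_successivelyE:
  assumes "\<not> successively T xs"
  obtains ys a b zs where "xs = ys @ a # b # zs" "\<not> T a b"
proof -
  have "\<exists>ys a b zs. xs = ys @ a # b # zs \<and> \<not> T a b"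
    using assms
  proof (induction T xs rule: successively.induct)
    case (3 T x y xs)
    show ?case
    proof (cases "T x y")
      case True
      then obtain ys a b zs where "y # xs = ys @ a # b # zs" "\<not> T a b" using 3 by auto
      then have "x # y # xs = (x # ys) @ a # b # zs \<and> \<not> T a b" by simp
      then show ?thesis by blast
    next
      case False
      then have "x # y # xs = [] @ x # y # xs \<and> \<not> T x y" by simp
      then show ?thesis by blast
    qed
  qed auto
  then show thesis using that by blast
qed

lemma concat_eq_appendE:
  assumes "concat gs = x @ l # y"
  obtains a g1 g2 b where "gs = a @ (g1 @ l # g2) # b" "x = concat a @ g1"
proof -
  have "\<exists>a g1 g2 b. gs = a @ (g1 @ l # g2) # b \<and> x = concat a @ g1"
    using assms
  proof (induction gs arbitrary: x)
    case (Cons g gs)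
    from Cons.prems consider us where "g = x @ us" "us @ concat gs = l # y"
      | us where "g @ us = x" "concat gs = us @ l # y"
      by (auto simp: append_eq_append_conv2)
    then show ?case
    proof cases
      case 1
      show ?thesis
      proof (cases us)
        case Nil
        then obtain a g1 g2 b where "gs = a @ (g1 @ l # g2) # b \<and> [] = concat a @ g1"
          using Cons.IH[of "[]"] 1 by auto
        then have "g # gs = (g # a) @ (g1 @ l # g2) # b \<and> x = concat (g # a) @ g1"
          using 1 Nil by simp
        then show ?thesis by blast
      next
        case (Cons m us')
        then have "g # gs = [] @ (x @ l # us') # gs \<and> x = concat [] @ x" using 1 by simp
        then show ?thesis by blast
      qed
    next
      case 2
      then obtain a g1 g2 b where "gs = a @ (g1 @ l # g2) # b \<and> us = concat a @ g1"
        using Cons.IH[of us] by auto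
      then have "g # gs = (g # a) @ (g1 @ l # g2) # b \<and> x = concat (g # a) @ g1"
        using 2 by auto
      then show ?thesis by blast
    qed
  qed simp
  then show thesis using that by blast
qed

lemma concat_in_words: "concat gs \<in> words Y \<longleftrightarrow> (\<forall>g\<in>set gs. g \<in> words Y)"
  by (induction gs) auto

context amalgam
begin

lemma factor_gens: "i \<in> {1, 2} \<Longrightarrow> X i \<subseteq> amalg_gens"
  by (auto simp: amalg_gens_def)

lemma factor_words: "i \<in> {1, 2} \<Longrightarrow> w \<in> words (X i) \<Longrightarrow> w \<in> words amalg_gens"
  using words_mono[OF factor_gens] by blast

lemma amalg_gens_letters: "l \<in> letters amalg_gens \<Longrightarrow> \<exists>i\<in>{1, 2}. l \<in> letters (X i)"
  by (auto simp: amalg_gens_def letters_def)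

lemma letters_factor_unique:
  "i \<in> {1, 2} \<Longrightarrow> j \<in> {1, 2} \<Longrightarrow> l \<in> letters (X i) \<Longrightarrow> l \<in> letters (X j) \<Longrightarrow> i = j"
  using disjoint_gens by (auto simp: letters_def)

lemma words_factor_unique:
  assumes "i \<in> {1, 2}" "j \<in> {1, 2}" "w \<in> words (X i)" "w \<in> words (X j)" "w \<noteq> []"
  shows "i = j"
  using assms letters_factor_unique[of i j "hd w"] by (cases w) auto

lemma group_amalg: "group amalg"
  unfolding amalg_def by (rule group_gp)

lemma val_in_carrier [simp]: "w \<in> words amalg_gens \<Longrightarrow> val w \<in> carrier amalg"
  by (simp add: amalg_def val_def)

lemma val_Nil [simp]: "val [] = \<one>\<^bsub>amalg\<^esub>"
  by (simp add: amalg_def val_def one_gp)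

lemma val_append:
  "u \<in> words amalg_gens \<Longrightarrow> v \<in> words amalg_gens \<Longrightarrow> val (u @ v) = val u \<otimes>\<^bsub>amalg\<^esub> val v"
  by (simp add: amalg_def val_def mult_elem)

lemma val_inv_word: "w \<in> words amalg_gens \<Longrightarrow> val (inv_word w) = inv\<^bsub>amalg\<^esub> val w"
  by (simp add: amalg_def val_def inv_elem)

lemma val_context:
  assumes "val v = val w" "v \<in> words amalg_gens" "w \<in> words amalg_gens"
    "a \<in> words amalg_gens" "b \<in> words amalg_gens"
  shows "val (a @ v @ b) = val (a @ w @ b)"
  using assms by (simp add: val_append)

text \<open>The defining relations of the factors are among those of the amalgam, so each factor acts on
  the cosets in the amalgam.\<close>

lemma pres_eq_factor:
  assumes i: "i \<in> {1, 2}" and "pres_eq (X i) (R i) u v"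
  shows "pres_eq amalg_gens amalg_rels u v"
  using assms(2)
proof (induction rule: pres_eq.induct)
  case (refl w)
  then show ?case by (intro pres_eq.refl factor_words[OF i])
next
  case (sym u v)
  show ?case by (rule pres_eq.sym[OF sym.IH])
next
  case (trans u v w)
  show ?case by (rule pres_eq.trans[OF trans.IH])
next
  case (cancel u v l)
  then show ?case
    using letters_mono[OF factor_gens[OF i]] by (intro pres_eq.cancel factor_words[OF i]) auto
next
  case (relator u v r)
  then have "r \<in> amalg_rels" using i by (auto simp: amalg_rels_def)
  then show ?case using relator by (intro pres_eq.relator factor_words[OF i])
qed

lemma val_factor_cong:
  assumes "i \<in> {1, 2}" "elem (X i) (R i) u = elem (X i) (R i) v" "u \<in> words (X i)" "v \<in> words (X i)"
  shows "val u = val v"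
  using elem_eqI[OF pres_eq_factor[OF assms(1), of u v]] assms by (simp add: val_def elem_eq_iff)

lemma group_hom_emb: "i \<in> {1, 2} \<Longrightarrow> group_hom A (gp (X i) (R i)) (\<phi> i)"
  using mono_emb group_A group_gp
  by (auto simp: group_hom_def group_hom_axioms_def mon_def)

lemma subgroup_amalgamated: "subgroup amalgamated amalg"
proof (rule group.subgroupI[OF group_amalg])
  let ?G1 = "gp (X 1) (R 1)" and ?K = "\<phi> 1 ` carrier A"
  have K: "subgroup ?K ?G1"
    using group_hom.img_is_subgroup[OF group_hom_emb[of 1]] by simp
  have W: "u \<in> words amalg_gens" if "u \<in> words (X 1)" for u using factor_words[of 1] that by simp
  show "amalgamated \<subseteq> carrier amalg" using W by (auto simp: amalgamated_def)
  have "elem (X 1) (R 1) [] \<in> ?K" using subgroup.one_closed[OF K] by (simp add: one_gp)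
  then have "val [] \<in> amalgamated" unfolding amalgamated_def by (intro CollectI exI[of _ "[]"]) simp
  then show "amalgamated \<noteq> {}" by blast
  show "inv\<^bsub>amalg\<^esub> x \<in> amalgamated" if "x \<in> amalgamated" for x
  proof -
    obtain u where u: "x = val u" "u \<in> words (X 1)" "elem (X 1) (R 1) u \<in> ?K"
      using \<open>x \<in> amalgamated\<close> unfolding amalgamated_def by blast
    then have "inv\<^bsub>amalg\<^esub> x = val (inv_word u)" "elem (X 1) (R 1) (inv_word u) \<in> ?K"
      using W subgroup.m_inv_closed[OF K u(3)] by (simp_all add: val_inv_word inv_elem)
    then show ?thesis using u(2) unfolding amalgamated_def by (intro CollectI exI[of _ "inv_word u"]) simp
  qed
  show "x \<otimes>\<^bsub>amalg\<^esub> y \<in> amalgamated" if x: "x \<in> amalgamated" and y: "y \<in> amalgamated" for x y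
  proof -
    obtain u v where u: "x = val u" "u \<in> words (X 1)" "elem (X 1) (R 1) u \<in> ?K"
      and v: "y = val v" "v \<in> words (X 1)" "elem (X 1) (R 1) v \<in> ?K"
      using x y unfolding amalgamated_def by blast
    then have "x \<otimes>\<^bsub>amalg\<^esub> y = val (u @ v)" "elem (X 1) (R 1) (u @ v) \<in> ?K"
      using W subgroup.m_closed[OF K u(3) v(3)] by (simp_all add: val_append mult_elem)
    then show ?thesis using u(2) v(2) unfolding amalgamated_def by (intro CollectI exI[of _ "u @ v"]) simp
  qed
qed

text \<open>For the second factor this is what the relators identifying the two images of \<open>A\<close> are for.\<close>

lemma amalgamated_in_factor:
  assumes "x \<in> amalgamated" "i \<in> {1, 2}"
  obtains v where "v \<in> words (X i)" "val v = x"
proof -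
  obtain u a where u: "x = val u" "u \<in> words (X 1)" and a: "a \<in> carrier A" "elem (X 1) (R 1) u = \<phi> 1 a"
    using assms(1) unfolding amalgamated_def by blast
  show thesis
  proof (cases "i = 1")
    case True
    then show thesis using u that by blast
  next
    case False
    then have i: "i = 2" using assms(2) by simp
    have "\<phi> 2 a \<in> carrier (gp (X 2) (R 2))"
      using group_hom.hom_closed[OF group_hom_emb[of 2] a(1)] by simp
    then obtain v where v: "v \<in> words (X 2)" "elem (X 2) (R 2) v = \<phi> 2 a"
      by (metis carrier_gpE)
    have W: "u \<in> words amalg_gens" "v \<in> words amalg_gens"
      using u v factor_words[of 1] factor_words[of 2] by auto
    have "u @ inv_word v \<in> amalg_rels"
      unfolding amalg_rels_def using u(2) v a by blast
    then have "pres_eq amalg_gens amalg_rels ([] @ (u @ inv_word v) @ v) ([] @ v)"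
      using W by (intro pres_eq.relator) auto
    then have "val (u @ inv_word v @ v) = val v" using elem_eqI by (fastforce simp: val_def)
    moreover have "val (u @ inv_word v @ v) = val u"
      using W by (simp add: val_append val_inv_word group.l_inv[OF group_amalg] monoid.r_one[OF group.is_monoid[OF group_amalg]])
    ultimately show thesis using that v(1) u(1) i by simp
  qed
qed

lemma normal_form_words: "normal_form gs \<Longrightarrow> concat gs \<in> words amalg_gens"
  unfolding normal_form_def concat_in_words using factor_words by blast

lemma different_factors_replace:
  assumes "g \<in> words (X i)" "g \<noteq> []" "g' \<in> words (X i)" "i \<in> {1, 2}"
  shows "different_factors g h \<Longrightarrow> different_factors g' h"
    and "different_factors h g \<Longrightarrow> different_factors h g'"
  unfolding different_factors_def using assms words_factor_unique[of i _ g] by metis+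

text \<open>Normality sees a syllable only through its factor and its value.\<close>

lemma normal_form_replace:
  assumes nf: "normal_form (a @ g # b)" and g: "g \<in> words (X i)" "g' \<in> words (X i)" "i \<in> {1, 2}"
    and val: "val g' = val g"
  shows "normal_form (a @ g' # b)"
proof -
  have "g \<noteq> []" using nf by (auto simp: normal_form_def)
  then show ?thesis
    using nf g val different_factors_replace[OF g(1) _ g(2,3)]
    unfolding normal_form_def by (fastforce simp: successively_append_iff successively_Cons)
qed

text \<open>A shortest factorisation into elements of the factors is a normal form: a trivial syllable
  can be dropped, neighbours from the same factor can be multiplied, and a syllable in the
  amalgamated subgroup can be absorbed by a neighbour, since it lies in both factors.\<close>

lemma normal_form_exists:
  assumes "x \<in> carrier amalg"
  obtains gs where "normal_form gs" "val (concat gs) = x"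
proof -
  define F where "F gs \<longleftrightarrow> (\<forall>g\<in>set gs. \<exists>i\<in>{1, 2}. g \<in> words (X i)) \<and> val (concat gs) = x" for gs
  obtain w where w: "w \<in> words amalg_gens" "x = val w"
    using assms unfolding amalg_def val_def by (rule carrier_gpE)
  have "F (map (\<lambda>l. [l]) w)"
    using w amalg_gens_letters by (auto simp: F_def dest: in_listsD)
  then obtain gs where gs: "F gs" and min: "\<And>hs. F hs \<Longrightarrow> length gs \<le> length hs"
    using ex_has_least_nat[of F _ length] by blast
  have W: "g \<in> words amalg_gens" if "g \<in> set gs" for g
    using gs that factor_words unfolding F_def by blast
  \<comment> \<open>No block \<open>c\<close> of the factorisation can be replaced by a shorter one with the same value.\<close>
  have shorter: False
    if "gs = a @ c @ b" "length d < length c" "\<forall>g\<in>set d. \<exists>i\<in>{1, 2}. g \<in> words (X i)"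
      "val (concat d) = val (concat c)" for a b c d
  proof -
    have "concat a \<in> words amalg_gens" "concat b \<in> words amalg_gens" "concat c \<in> words amalg_gens"
      using W that(1) by (simp_all add: concat_in_words)
    moreover have "concat d \<in> words amalg_gens"
      using that(3) factor_words unfolding concat_in_words by blast
    ultimately have "val (concat (a @ d @ b)) = val (concat gs)"
      using val_context[OF that(4)] that(1) by simp
    then have "F (a @ d @ b)" using gs that(1,3) unfolding F_def by auto
    from min[OF this] show False using that(1,2) by simp
  qed
  have nontrivial: "val g \<noteq> \<one>\<^bsub>amalg\<^esub>" if "g \<in> set gs" for g
  proof
    assume "val g = \<one>\<^bsub>amalg\<^esub>"
    moreover obtain a b where "gs = a @ [g] @ b" using \<open>g \<in> set gs\<close> by (auto dest: split_list)
    ultimately show False using shorter[of a "[g]" b "[]"] by simp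
  qed
  have same: False if "gs = a @ [g, h] @ b" "g \<in> words (X i)" "h \<in> words (X i)" "i \<in> {1, 2}" for a g h b i
    using shorter[OF that(1), of "[g @ h]"] that(2-4) by auto
  have "successively different_factors gs"
  proof (rule ccontr)
    assume "\<not> successively different_factors gs"
    then obtain a g h b where s: "gs = a @ g # h # b" "\<not> different_factors g h"
      by (rule not_successivelyE)
    then obtain i j where "i \<in> {1, 2}" "j \<in> {1, 2}" "g \<in> words (X i)" "h \<in> words (X j)"
      using gs unfolding F_def by auto
    then show False using s same[of a g h b i] unfolding different_factors_def by auto
  qed
  moreover have "val g \<notin> amalgamated" if "g \<in> set gs" "length gs \<noteq> 1" for g
  proof
    assume A: "val g \<in> amalgamated"
    obtain a b where ab: "gs = a @ g # b" using \<open>g \<in> set gs\<close> by (auto dest: split_list)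
    then consider a' h where "a = a' @ [h]" | h b' where "b = h # b'"
      using \<open>length gs \<noteq> 1\<close> by (cases a rule: rev_cases; cases b) auto
    then show False
    proof cases
      case 1
      then obtain j where j: "j \<in> {1, 2}" "h \<in> words (X j)" using gs ab unfolding F_def by auto
      obtain v where v: "v \<in> words (X j)" "val v = val g" using amalgamated_in_factor[OF A j(1)] .
      have "val (h @ v) = val (h @ g)"
        using v(2) W[of g] W[of h] ab 1 factor_words[OF j(1) v(1)] by (simp add: val_append)
      then show False using shorter[of a' "[h, g]" b "[h @ v]"] ab 1 j v(1) by auto
    next
      case 2
      then obtain j where j: "j \<in> {1, 2}" "h \<in> words (X j)" using gs ab unfolding F_def by auto
      obtain v where v: "v \<in> words (X j)" "val v = val g" using amalgamated_in_factor[OF A j(1)] .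
      have "val (v @ h) = val (g @ h)"
        using v(2) W[of g] W[of h] ab 2 factor_words[OF j(1) v(1)] by (simp add: val_append)
      then show False using shorter[of a "[g, h]" b' "[v @ h]"] ab 2 j v(1) by auto
    qed
  qed
  ultimately have "normal_form gs" using gs nontrivial unfolding normal_form_def F_def by blast
  then show thesis using that gs unfolding F_def by blast
qed

end


section \<open>The normal core\<close>

locale amalgam_subgroup = amalgam X R A \<phi>
  for X :: "nat \<Rightarrow> 'x set" and R :: "nat \<Rightarrow> 'x word set"
    and A :: "('a, 'm) monoid_scheme" and \<phi> :: "nat \<Rightarrow> 'a \<Rightarrow> 'x word set" +
  fixes H :: "'x word set set"
  assumes subgroup_H: "subgroup H amalg"

sublocale amalgam_subgroup \<subseteq> cayley_graph amalg_gens amalg_rels H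
  by (rule cayley_graph.intro) (rule subgroup_H[unfolded amalg_def])

context amalgam_subgroup
begin

lemma act_val_cong: "val u = val v \<Longrightarrow> act c u = act c v"
  unfolding val_def by (rule act_cong)

lemma base_closed_iff: "w \<in> words amalg_gens \<Longrightarrow> act H w = H \<longleftrightarrow> val w \<in> H"
  unfolding val_def by (rule act_base_iff)

lemma base_coset: "H #>\<^bsub>amalg\<^esub> \<one>\<^bsub>amalg\<^esub> = H"
  using S_carrier unfolding amalg_def by (intro group.coset_mult_one group_gp)

lemma symmetric_part_Cayley: "symmetric_part cosets (cosets \<times> letters amalg_gens)"
  by (auto simp: symmetric_part_def)

lemma Cayley_amalg_part: "Cayley_amalg H = part cosets (cosets \<times> letters amalg_gens)"
  unfolding Cayley_amalg_def by (rule Cayley_eq_part)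

lemma set_read_cosets:
  assumes "c \<in> cosets" "w \<in> words amalg_gens"
  shows "set (read c w) \<subseteq> cosets \<times> letters amalg_gens"
proof
  fix e assume "e \<in> set (read c w)"
  then obtain a l b where "w = a @ l # b" "e = (act c a, l)"
    using mem_read_iff[OF assms] by blast
  then show "e \<in> cosets \<times> letters amalg_gens" using assms by simp
qed

text \<open>The list of the paths that read the syllables of \<open>gs\<close> one after the other: the monochromatic
  decomposition of the reading of a normal word.\<close>

primrec reads :: "'x word set set \<Rightarrow> 'x word list \<Rightarrow> ('x word set set \<times> 'x letter) list list" where
  "reads c [] = []"
| "reads c (g # gs) = read c g # reads (act c g) gs"

lemma map_reads [simp]: "map (map snd) (reads c gs) = gs"
  by (induction gs arbitrary: c) auto

lemma concat_reads:
  "c \<in> cosets \<Longrightarrow> \<forall>g\<in>set gs. g \<in> words amalg_gens \<Longrightarrow> concat (reads c gs) = read c (concat gs)"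
  by (induction gs arbitrary: c) (auto simp: read_append concat_in_words)

definition closed_normal :: "'x word list \<Rightarrow> bool" where
  "closed_normal gs \<longleftrightarrow> normal_form gs \<and> val (concat gs) \<in> H"

lemma normal_path_iff:
  "normal_path (Cayley_amalg H) H p H \<longleftrightarrow> (\<exists>gs. closed_normal gs \<and> p = read H (concat gs))"
proof
  assume "normal_path (Cayley_amalg H) H p H"
  then obtain ps where ps: "path (part cosets (cosets \<times> letters amalg_gens)) H p H"
    "concat ps = p" "normal_form (map (map snd) ps)"
    unfolding normal_path_def mono_decomposition_def Cayley_amalg_part by auto
  have p: "p = read H (map snd p)" "map snd p \<in> words amalg_gens" "act H (map snd p) = H"
    using ps(1) unfolding path_part_iff[OF symmetric_part_Cayley] by auto
  moreover have "map snd p = concat (map (map snd) ps)" using ps(2) by (auto simp: map_concat)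
  ultimately have "closed_normal (map (map snd) ps) \<and> p = read H (concat (map (map snd) ps))"
    using ps(3) base_closed_iff[of "map snd p"] unfolding closed_normal_def by simp
  then show "\<exists>gs. closed_normal gs \<and> p = read H (concat gs)" by blast
next
  assume "\<exists>gs. closed_normal gs \<and> p = read H (concat gs)"
  then obtain gs where gs: "normal_form gs" "val (concat gs) \<in> H" "p = read H (concat gs)"
    unfolding closed_normal_def by blast
  note W = normal_form_words[OF gs(1)]
  have mem: "map snd q \<in> set gs" if "q \<in> set (reads H gs)" for q
    using that map_reads[of H gs] by (metis image_eqI list.set_map)
  have g: "g \<noteq> []" "\<exists>i\<in>{1, 2}. g \<in> words (X i)" if "g \<in> set gs" for g
    using that gs(1) unfolding normal_form_def by auto
  have "mono_decomposition (Cayley_amalg H) p (reads H gs)"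
    unfolding mono_decomposition_def Cayley_amalg_part part_simps
  proof (intro conjI ballI)
    show "concat (reads H gs) = p"
      using W gs(3) by (simp add: concat_reads concat_in_words)
    have "successively different_factors (map (map snd) (reads H gs))"
      using gs(1) by (simp add: normal_form_def)
    then show "successively (\<lambda>q q'. different_factors (map snd q) (map snd q')) (reads H gs)"
      unfolding successively_map .
    fix q assume "q \<in> set (reads H gs)"
    then show "q \<noteq> []" "\<exists>i\<in>{1, 2}. map snd q \<in> words (X i)" using g[OF mem] by auto
  qed
  moreover have "path (Cayley_amalg H) H p H"
    unfolding Cayley_amalg_part path_part_iff[OF symmetric_part_Cayley]
    using gs W set_read_cosets[OF base_in_cosets W] base_closed_iff[OF W] by simp
  ultimately show "normal_path (Cayley_amalg H) H p H"
    unfolding normal_path_def using gs(1) by (auto simp: Cayley_amalg_part)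
qed

definition core_arcs :: "('x word set set \<times> 'x letter) set" where
  "core_arcs = (\<Union>gs\<in>Collect closed_normal. set (read H (concat gs)) \<union>
     (\<lambda>e. (act (fst e) [snd e], inv_letter (snd e))) ` set (read H (concat gs)))"

definition core_verts :: "'x word set set set" where
  "core_verts = insert H (fst ` core_arcs)"

lemma closed_normal_words: "closed_normal gs \<Longrightarrow> concat gs \<in> words amalg_gens"
  unfolding closed_normal_def using normal_form_words by blast

lemma core_arcsE:
  assumes "e \<in> core_arcs"
  obtains gs a l b where "closed_normal gs" "concat gs = a @ l # b"
    "e = (act H a, l) \<or> e = (act H (a @ [l]), inv_letter l)"
proof -
  obtain gs e' where gs: "closed_normal gs" "e' \<in> set (read H (concat gs))"
    "e = e' \<or> e = (act (fst e') [snd e'], inv_letter (snd e'))"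
    using assms unfolding core_arcs_def by blast
  note W = closed_normal_words[OF gs(1)]
  obtain a l b where e': "concat gs = a @ l # b" "e' = (act H a, l)"
    using gs(2) mem_read_iff[OF base_in_cosets W] by blast
  then have "act (act H a) [l] = act H (a @ [l])" using W by (simp add: act_append)
  then show thesis using that[OF gs(1) e'(1)] gs(3) e'(2) by auto
qed

lemma core_arcsI:
  assumes "closed_normal gs" "concat gs = a @ l # b"
  shows "(act H a, l) \<in> core_arcs" "(act H (a @ [l]), inv_letter l) \<in> core_arcs"
proof -
  note W = closed_normal_words[OF assms(1)]
  have *: "(act H a, l) \<in> set (read H (concat gs))"
    using mem_read_iff[OF base_in_cosets W] assms(2) by blast
  then show "(act H a, l) \<in> core_arcs" using assms(1) unfolding core_arcs_def by blast
  have "act (act H a) [l] = act H (a @ [l])" using W assms(2) by (simp add: act_append)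
  moreover have "(act (act H a) [l], inv_letter l) \<in> core_arcs"
    using * assms(1) unfolding core_arcs_def by force
  ultimately show "(act H (a @ [l]), inv_letter l) \<in> core_arcs" by simp
qed

lemma symmetric_part_core: "symmetric_part core_verts core_arcs"
proof -
  have *: "c \<in> cosets \<and> l \<in> letters amalg_gens \<and> (act c [l], inv_letter l) \<in> core_arcs"
    if "(c, l) \<in> core_arcs" for c l
    using that
  proof (rule core_arcsE)
    fix gs a m b
    assume gs: "closed_normal gs" "concat gs = a @ m # b"
      and cl: "(c, l) = (act H a, m) \<or> (c, l) = (act H (a @ [m]), inv_letter m)"
    have W: "a \<in> words amalg_gens" "m \<in> letters amalg_gens"
      using closed_normal_words[OF gs(1)] gs(2) by auto
    have a: "act H (a @ [m]) = act (act H a) [m]" using W by (simp add: act_append)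
    show ?thesis using cl core_arcsI[OF gs] W unfolding a by auto
  qed
  have "c \<in> core_verts" if "(c, l) \<in> core_arcs" for c l
    using that by (force simp: core_verts_def)
  moreover have "core_verts \<subseteq> cosets" using * by (auto simp: core_verts_def)
  ultimately show ?thesis using * by (auto simp: symmetric_part_def)
qed

lemma set_awalk_verts:
  assumes "pre_digraph.cas D u p v"
  shows "set (pre_digraph.awalk_verts D u p) = insert u (tail D ` set p \<union> head D ` set p)"
  using assms
proof (induction p arbitrary: u)
  case (Cons e p)
  have "tail D e = u" "pre_digraph.cas D (head D e) p v"
    using Cons.prems by (auto simp: pre_digraph.cas.simps)
  then show ?case using Cons.IH[of "head D e"] by (auto simp: pre_digraph.awalk_verts.simps)
qed (simp add: pre_digraph.awalk_verts.simps)

lemma normal_core_eq_part: "normal_core H = part core_verts core_arcs"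
proof -
  let ?\<Gamma> = "Cayley_amalg H"
  have N: "{p. normal_path ?\<Gamma> H p H} = (\<lambda>gs. read H (concat gs)) ` Collect closed_normal"
    using normal_path_iff by blast
  have E: "(\<Union>p\<in>{p. normal_path ?\<Gamma> H p H}. set p \<union> inv_arc ?\<Gamma> ` set p) = core_arcs"
    by (subst N) (simp add: core_arcs_def Cayley_amalg_part)
  have V: "(\<Union>p\<in>{p. normal_path ?\<Gamma> H p H}. set (pre_digraph.awalk_verts (dg ?\<Gamma>) H p)) = core_verts"
  proof -
    have verts: "set (pre_digraph.awalk_verts (dg ?\<Gamma>) H p) =
        insert H (fst ` (set p \<union> inv_arc ?\<Gamma> ` set p))" if "normal_path ?\<Gamma> H p H" for p
    proof -
      have "pre_digraph.cas (dg ?\<Gamma>) H p H"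
        using that by (simp add: normal_path_def pre_digraph.awalk_def)
      from set_awalk_verts[OF this] show ?thesis
        by (simp add: Cayley_amalg_part image_Un image_image)
    qed
    have "normal_form []" by (simp add: normal_form_def)
    moreover have "val [] \<in> H" using subgroup.one_closed[OF subgroup_H] by simp
    ultimately have "normal_path ?\<Gamma> H [] H"
      unfolding normal_path_iff closed_normal_def by (intro exI[of _ "[]"]) simp
    then have ne: "{p. normal_path ?\<Gamma> H p H} \<noteq> {}" by blast
    have "(\<Union>p\<in>{p. normal_path ?\<Gamma> H p H}. set (pre_digraph.awalk_verts (dg ?\<Gamma>) H p)) =
        (\<Union>p\<in>{p. normal_path ?\<Gamma> H p H}. insert H (fst ` (set p \<union> inv_arc ?\<Gamma> ` set p)))"
      using verts by simp
    also have "\<dots> = insert H (fst ` (\<Union>p\<in>{p. normal_path ?\<Gamma> H p H}. set p \<union> inv_arc ?\<Gamma> ` set p))"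
      using ne by blast
    finally show ?thesis unfolding E core_verts_def .
  qed
  show ?thesis
    unfolding normal_core_def base_coset Let_def V E
    by (simp add: Cayley_amalg_part part_def)
qed


section \<open>The components of the normal core\<close>

text \<open>Replace the syllable \<open>g\<close> by \<open>w l l\<inverse> w\<inverse> g\<close>, where \<open>w\<close> leads to the initial vertex of the
  desired arc and \<open>l\<close> is its label. This word is over \<open>X i\<close> and has the value of \<open>g\<close>, so the path
  remains normal and closed.\<close>

lemma syllable_component_in_core:
  assumes gs: "closed_normal (a @ g # b)" and i: "i \<in> {1, 2}" and g: "g \<in> words (X i)"
  shows "component_verts (X i) (act H (concat a)) \<times> letters (X i) \<subseteq> core_arcs"
proof safe
  fix c l1 l2 assume c: "c \<in> component_verts (X i) (act H (concat a))" and "(l1, l2) \<in> letters (X i)"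
  then obtain l where l: "l = (l1, l2)" "l \<in> letters (X i)" by blast
  obtain w where w: "w \<in> words (X i)" "c = act (act H (concat a)) w"
    using c by (auto simp: component_verts_def)
  define g' where "g' = w @ l # inv_letter l # inv_word w @ g"
  have W: "concat a \<in> words amalg_gens" "concat b \<in> words amalg_gens" "w \<in> words amalg_gens"
      "g \<in> words amalg_gens" "l \<in> letters amalg_gens"
    using closed_normal_words[OF gs] factor_words[OF i] w g letters_mono[OF factor_gens[OF i]] l
    by auto
  have g': "g' \<in> words (X i)" using w g l by (simp add: g'_def)
  have val_g': "val g' = val g"
  proof -
    have "pres_eq amalg_gens amalg_rels ([] @ ((w @ [l]) @ inv_word (w @ [l])) @ g) ([] @ [] @ g)"
      using W by (intro pres_eq_context pres_eq_inverse) auto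
    moreover have "inv_word (w @ [l]) = inv_letter l # inv_word w" by (simp add: inv_word_def)
    ultimately show ?thesis using elem_eqI by (fastforce simp: g'_def val_def)
  qed
  have "normal_form (a @ g' # b)"
    using gs normal_form_replace[OF _ g g' i val_g'] unfolding closed_normal_def by blast
  moreover have "val (concat (a @ g' # b)) = val (concat (a @ g # b))"
    using val_context[OF val_g', of "concat a" "concat b"] W factor_words[OF i g'] by simp
  ultimately have "closed_normal (a @ g' # b)" using gs unfolding closed_normal_def by simp
  then have "(act H (concat a @ w), l) \<in> core_arcs"
    by (rule core_arcsI) (simp add: g'_def)
  then show "(c, l1, l2) \<in> core_arcs" using w W l by (simp add: act_append)
qed

text \<open>A letter over \<open>X i\<close> occurs in a syllable over \<open>X i\<close>, because the alphabets are disjoint; the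
  other arcs of the core are inverses of such arcs and belong to the same orbits.\<close>

lemma core_arc_syllableE:
  assumes e: "(c, l) \<in> core_arcs" and i: "i \<in> {1, 2}" and l: "l \<in> letters (X i)"
  obtains a g b where "closed_normal (a @ g # b)" "g \<in> words (X i)"
    "c \<in> component_verts (X i) (act H (concat a))"
proof -
  obtain gs x m y where gs: "closed_normal gs" "concat gs = x @ m # y"
    and cl: "(c, l) = (act H x, m) \<or> (c, l) = (act H (x @ [m]), inv_letter m)"
    using e by (rule core_arcsE)
  have m: "m \<in> letters (X i)" using cl l by auto
  obtain a g1 g2 b where g: "gs = a @ (g1 @ m # g2) # b" "x = concat a @ g1"
    using gs(2) by (rule concat_eq_appendE)
  obtain k where k: "k \<in> {1, 2}" "g1 @ m # g2 \<in> words (X k)"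
    using gs(1) g(1) unfolding closed_normal_def normal_form_def by auto
  have "m \<in> letters (X k)" using k(2) by simp
  then have "k = i" using letters_factor_unique[OF k(1) i _ m] by blast
  have W: "concat a \<in> words amalg_gens" using closed_normal_words[OF gs(1)] g(1) by simp
  have g1: "g1 \<in> words (X i)" "g1 @ [m] \<in> words (X i)" using k(2) m \<open>k = i\<close> by auto
  have "act H x = act (act H (concat a)) g1" "act H (x @ [m]) = act (act H (concat a)) (g1 @ [m])"
    using g(2) W factor_words[OF i g1(1)] factor_words[OF i g1(2)] by (simp_all add: act_append)
  then have "c \<in> component_verts (X i) (act H (concat a))" using cl g1 by auto
  then show thesis using that[of a "g1 @ m # g2" b] gs(1) g(1) k(2) \<open>k = i\<close> by simp
qed

lemma syllable_vertices:
  assumes gs: "closed_normal (a @ g # b)" and i: "i \<in> {1, 2}" and g: "g \<in> words (X i)"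
  shows "act H (concat a) \<in> cosets" "act H (concat (a @ [g])) = act (act H (concat a)) g"
    "act H (concat (a @ [g])) \<in> component_verts (X i) (act H (concat a))"
proof -
  have W: "concat a \<in> words amalg_gens" "g \<in> words amalg_gens"
    using closed_normal_words[OF gs] by auto
  then show "act H (concat a) \<in> cosets" by simp
  show "act H (concat (a @ [g])) = act (act H (concat a)) g" using W by (simp add: act_append)
  then show "act H (concat (a @ [g])) \<in> component_verts (X i) (act H (concat a))" using g by auto
qed

lemma saturated_core:
  assumes i: "i \<in> {1, 2}"
  shows "saturated (X i) core_arcs"
  unfolding saturated_def
proof (intro allI impI, elim conjE)
  fix c l assume "(c, l) \<in> core_arcs" "l \<in> letters (X i)"
  then obtain a g b where g: "closed_normal (a @ g # b)" "g \<in> words (X i)"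
    "c \<in> component_verts (X i) (act H (concat a))"
    using core_arc_syllableE[OF _ i] by blast
  show "component_verts (X i) c \<times> letters (X i) \<subseteq> core_arcs"
    using syllable_component_in_core[OF g(1) i g(2)]
      component_verts_eq[OF factor_gens[OF i] syllable_vertices(1)[OF g(1) i g(2)] g(3)] by simp
qed

lemmas core_component_eq =
  saturated_mono_component_eq[OF saturated_core symmetric_part_core factor_gens]
lemmas core_component =
  saturated_mono_component[OF saturated_core symmetric_part_core factor_gens]

lemma Lab_component:
  assumes "i \<in> {1, 2}" "u \<in> cosets"
  shows "Lab (component (X i) u) u = {val w | w. w \<in> words (X i) \<and> act u w = u}"
proof -
  have lab: "lab (component (X i) u) = snd" by (simp add: component_def)
  show ?thesis
    unfolding Lab_def path_component_iff[OF factor_gens[OF assms(1)] assms(2) self_in_component_verts[OF assms(2)]] lab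
    by force
qed

text \<open>Elements of the amalgamated subgroup are values of words over either alphabet, so the right
  side does not depend on \<open>i\<close>.\<close>

lemma Lab_component_base_amalgamated:
  assumes i: "i \<in> {1, 2}"
  shows "Lab (component (X i) H) H \<inter> amalgamated = H \<inter> amalgamated"
proof -
  have *: "Lab (component (X i) H) H = {val w | w. w \<in> words (X i) \<and> val w \<in> H}"
    unfolding Lab_component[OF i base_in_cosets] using base_closed_iff factor_words[OF i] by blast
  show ?thesis
  proof (intro subset_antisym subsetI)
    fix x assume "x \<in> H \<inter> amalgamated"
    moreover from this obtain v where "v \<in> words (X i)" "val v = x"
      using amalgamated_in_factor[OF _ i] by blast
    ultimately show "x \<in> Lab (component (X i) H) H \<inter> amalgamated" unfolding * by blast
  qed (auto simp: *)
qed

lemma path_core_read: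
  assumes "closed_normal gs" "concat gs = x @ y"
  shows "path (part core_verts core_arcs) H (read H x) (act H x)"
proof -
  have W: "x \<in> words amalg_gens" "y \<in> words amalg_gens"
    using closed_normal_words[OF assms(1)] assms(2) by auto
  have "set (read H x) \<subseteq> set (read H (concat gs))" using W assms(2) by (simp add: read_append)
  also have "\<dots> \<subseteq> core_arcs" using assms(1) unfolding core_arcs_def by blast
  finally show ?thesis
    unfolding path_part_iff[OF symmetric_part_core] using W by (simp add: core_verts_def)
qed

lemma closed_normal_Nil: "closed_normal []"
  using subgroup.one_closed[OF subgroup_H] by (simp add: closed_normal_def normal_form_def)

lemma connected_core: "Digraph_Component.connected (dg (part core_verts core_arcs))"
proof (rule connected_part[OF symmetric_part_core])
  show "H \<in> core_verts" by (simp add: core_verts_def)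
  fix v assume "v \<in> core_verts"
  then consider "v = H" | l where "(v, l) \<in> core_arcs" by (auto simp: core_verts_def)
  then show "\<exists>p. path (part core_verts core_arcs) H p v"
  proof cases
    case 1
    then show ?thesis using path_core_read[OF closed_normal_Nil, of "[]" "[]"] by auto
  next
    case 2
    then obtain gs a m b where gs: "closed_normal gs" "concat gs = a @ m # b"
      and v: "v = act H a \<or> v = act H (a @ [m])"
      by (elim core_arcsE) auto
    then show ?thesis
      using path_core_read[OF gs] path_core_read[OF gs(1), of "a @ [m]" b] by auto
  qed
qed

text \<open>A word of value \<open>\<one>\<close> fixes every coset.\<close>

lemma G_based_part:
  assumes "symmetric_part V E"
  shows "G_based (part V E)"
  unfolding G_based_def path_part_iff[OF assms] part_simps
proof (intro allI impI, elim conjE)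
  fix u p v
  assume "u \<in> V" "v = act u (map snd p)" "val (map snd p) = \<one>\<^bsub>amalg\<^esub>"
  then show "u = v" using act_val_cong[of "map snd p" "[]" u] symmetric_part_verts[OF assms] by simp
qed

lemma precover_core: "precover (part core_verts core_arcs) H"
  unfolding precover_def
proof (intro conjI ballI allI impI)
  show "labelled_graph amalg_gens (part core_verts core_arcs)"
    using symmetric_part_arc(3)[OF symmetric_part_core]
    by (intro symmetric_part_labelled_graph symmetric_part_core) auto
  show "H \<in> lverts (part core_verts core_arcs)" by (simp add: core_verts_def)
  fix i :: nat and C assume i: "i \<in> {1, 2}" and C: "mono_component (X i) (part core_verts core_arcs) C"
  have "lverts C \<noteq> {}"
    using C unfolding mono_component_def mono_subgraph_def connected_def strongly_connected_def by auto
  then obtain u where u: "u \<in> lverts C" by blast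
  have "C = component (X i) u" "u \<in> cosets"
    using core_component_eq[OF i i C u] symmetric_part_verts[OF symmetric_part_core] by auto
  then show "is_cover (X i) (R i) C"
    using is_cover_component[OF factor_gens[OF i] _ val_factor_cong[OF i, unfolded val_def], of u] by simp
qed (auto intro: connected_core G_based_part symmetric_part_core)

lemma Lab_core: "Lab (part core_verts core_arcs) H = H"
proof (intro subset_antisym subsetI)
  fix x assume "x \<in> Lab (part core_verts core_arcs) H"
  then obtain p where "path (part core_verts core_arcs) H p H" "x = val (map snd p)"
    unfolding Lab_def by auto
  then show "x \<in> H"
    unfolding path_part_iff[OF symmetric_part_core] using base_closed_iff[of "map snd p"] by simp
next
  fix x assume x: "x \<in> H"
  then have "x \<in> carrier amalg" using subgroup.subset[OF subgroup_H] by blast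
  then obtain gs where gs: "normal_form gs" "val (concat gs) = x" by (rule normal_form_exists)
  then have c: "closed_normal gs" using x unfolding closed_normal_def by simp
  have "path (part core_verts core_arcs) H (read H (concat gs)) H"
    using path_core_read[OF c, of "concat gs" "[]"] base_closed_iff[OF closed_normal_words[OF c]] x gs by simp
  then show "x \<in> Lab (part core_verts core_arcs) H"
    unfolding Lab_def using gs(2) by force
qed


section \<open>The normal core is reduced\<close>

text \<open>At the vertex between two consecutive syllables, the components of both syllables meet, and
  both are contained in the core.\<close>

lemma bichromatic_coreI:
  assumes gs: "closed_normal (a @ g # h # b)"
  shows "bichromatic (part core_verts core_arcs) (act H (concat (a @ [g])))"
proof -
  let ?u = "act H (concat (a @ [g]))"
  have "successively different_factors (a @ g # h # b)"
    using gs unfolding closed_normal_def normal_form_def by blast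
  then have "different_factors g h" by (simp add: successively_append_iff)
  then obtain i j where ij: "i \<in> {1, 2}" "j \<in> {1, 2}" "i \<noteq> j" "g \<in> words (X i)" "h \<in> words (X j)"
    unfolding different_factors_def by blast
  have ne: "g \<noteq> []" "h \<noteq> []" using gs unfolding closed_normal_def normal_form_def by auto
  then obtain l m where "l \<in> letters (X i)" "m \<in> letters (X j)"
    using ij by (cases g; cases h) auto
  moreover have "component_verts (X i) (act H (concat a)) \<times> letters (X i) \<subseteq> core_arcs"
    by (rule syllable_component_in_core[OF gs ij(1,4)])
  moreover have "?u \<in> component_verts (X i) (act H (concat a))"
    by (rule syllable_vertices(3)[OF gs ij(1,4)])
  moreover have gs': "closed_normal ((a @ [g]) @ h # b)" using gs by simp
  moreover have "component_verts (X j) ?u \<times> letters (X j) \<subseteq> core_arcs" "?u \<in> component_verts (X j) ?u"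
    using syllable_component_in_core[OF gs' ij(2,5)] syllable_vertices(1)[OF gs' ij(2,5)] by auto
  ultimately have arcs: "(?u, l) \<in> core_arcs" "l \<in> letters (X i)" "(?u, m) \<in> core_arcs" "m \<in> letters (X j)"
    by blast+
  have "\<exists>e\<in>core_arcs. fst e = ?u \<and> snd e \<in> letters (X k)" if "k \<in> {1, 2}" for k
  proof -
    have "k = i \<or> k = j" using that ij by auto
    then show ?thesis using arcs by force
  qed
  moreover have "?u \<in> core_verts" using arcs(1) by (force simp: core_verts_def)
  ultimately show ?thesis by (simp add: bichromatic_def)
qed

lemma A_orbit_componentE:
  assumes i: "i \<in> {1, 2}" and u: "u \<in> cosets" and v: "v \<in> A_orbit (component (X i) u) u"
  obtains w where "w \<in> words (X i)" "val w \<in> amalgamated" "v = act u w"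
proof -
  obtain p where p: "path (component (X i) u) u p v" "val (plab (component (X i) u) p) \<in> amalgamated"
    using v by (auto simp: A_orbit_def)
  then obtain w where "w \<in> words (X i)" "p = read u w" "v = act u w"
    using path_component_iff[OF factor_gens[OF i] u self_in_component_verts[OF u]] by blast
  then show thesis using that p(2) by (simp add: component_def)
qed

text \<open>The component contains the reading of a syllable \<open>g\<close> of a closed normal word, from \<open>s\<close> to \<open>t\<close>.
  Being at the beginning or end of the path, or at a change of colour, \<open>s\<close> and \<open>t\<close> are controlled by
  the conditions on bichromatic vertices and on the basepoint.\<close>

lemma core_not_redundant:
  assumes "some_component (part core_verts core_arcs) C"
  shows "\<not> redundant (part core_verts core_arcs) H C"
proof
  let ?\<Delta> = "part core_verts core_arcs"
  assume red: "redundant ?\<Delta> H C"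
  obtain i where i: "i \<in> {1, 2}" and C: "mono_component (X i) ?\<Delta> C"
    using assms unfolding some_component_def by blast
  note Z = factor_gens[OF i]
  have "larcs C \<noteq> {}" "lverts C \<noteq> {}"
    using C unfolding mono_component_def mono_subgraph_def connected_def strongly_connected_def by auto
  then obtain u where u: "u \<in> lverts C" by blast
  obtain l where l: "l \<in> letters (X i)" "(u, l) \<in> core_arcs" using core_component_eq(3)[OF i i C u] by blast
  obtain a g b where gs: "closed_normal (a @ g # b)" and g: "g \<in> words (X i)"
    and u_g: "u \<in> component_verts (X i) (act H (concat a))"
    using l(2) i l(1) by (rule core_arc_syllableE)
  define s t where "s = act H (concat a)" and "t = act H (concat (a @ [g]))"
  note sv = syllable_vertices[OF gs i g, folded s_def t_def]
  have "u \<in> cosets" using component_verts_cosets[OF Z sv(1)] u_g s_def by blast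
  have C_s: "C = component (X i) s" using core_component_eq(1)[OF i i C u] component_eq[OF Z sv(1)] u_g s_def by simp
  have verts_C: "s \<in> lverts C" "t \<in> lverts C" using sv by (auto simp: C_s component_def)
  have normal: "normal_form (a @ g # b)" and g_ne: "val g \<noteq> \<one>\<^bsub>amalg\<^esub>" "g \<noteq> []"
    using gs unfolding closed_normal_def normal_form_def by auto
  have W: "concat a \<in> words amalg_gens" "g \<in> words amalg_gens"
    using closed_normal_words[OF gs] by auto
  have s_VB: "s \<in> VB ?\<Delta> C" if "a \<noteq> []"
  proof -
    obtain a' h where "a = a' @ [h]" using \<open>a \<noteq> []\<close> by (cases a rule: rev_cases) auto
    then show ?thesis using bichromatic_coreI[of a' h g b] gs verts_C by (simp add: VB_def s_def)
  qed
  have t_VB: "t \<in> VB ?\<Delta> C" if "b \<noteq> []"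
  proof -
    obtain h b' where "b = h # b'" using \<open>b \<noteq> []\<close> by (cases b) auto
    then show ?thesis using bichromatic_coreI[of a g h b'] gs verts_C by (simp add: VB_def t_def)
  qed
  have s_H: "s = H" if "a = []" using that by (simp add: s_def)
  have t_H: "t = H" if "b = []"
    using that gs base_closed_iff[OF closed_normal_words[OF gs]] by (simp add: t_def closed_normal_def)
  from red consider "?\<Delta> = C" "Lab C H = {\<one>\<^bsub>amalg\<^esub>}"
    | \<theta> where "\<theta> \<in> VB ?\<Delta> C" "Lab C \<theta> \<subseteq> amalgamated" "VB ?\<Delta> C = A_orbit C \<theta>"
      "H \<notin> lverts C \<or> (H \<in> VB ?\<Delta> C \<and> Lab C \<theta> = {\<one>\<^bsub>amalg\<^esub>})"
    unfolding redundant_def by blast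
  then show False
  proof cases
    case 1
    have mono: "m \<in> letters (X i)" if "(c, m) \<in> core_arcs" for c m
      using that C 1(1)[symmetric] unfolding mono_component_def mono_subgraph_def by auto
    \<comment> \<open>A single component has no bichromatic vertices, so \<open>g\<close> has no neighbours.\<close>
    have not_bi: "\<not> bichromatic ?\<Delta> v" for v
    proof
      assume bi: "bichromatic ?\<Delta> v"
      define j :: nat where "j = 3 - i"
      have j: "j \<in> {1, 2}" "j \<noteq> i" using i by (auto simp: j_def)
      then obtain c m where "(c, m) \<in> core_arcs" "m \<in> letters (X j)"
        using bi by (fastforce simp: bichromatic_def)
      then show False using mono letters_factor_unique[OF j(1) i, of m] j(2) by blast
    qed
    then have "a = []" "b = []" using s_VB t_VB by (auto simp: VB_def)
    then have "val g \<in> H" using gs by (simp add: closed_normal_def)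
    moreover have "Lab C H = H" unfolding 1(1)[symmetric] by (rule Lab_core)
    ultimately have "val g \<in> {\<one>\<^bsub>amalg\<^esub>}" using 1(2) by blast
    then show False using g_ne by blast
  next
    case 2
    have \<theta>: "\<theta> \<in> lverts C" using 2(1) by (simp add: VB_def)
    have C_\<theta>: "C = component (X i) \<theta>" and \<theta>_cos: "\<theta> \<in> cosets"
      using core_component_eq[OF i i C \<theta>] symmetric_part_verts[OF symmetric_part_core] by auto
    have "s \<in> VB ?\<Delta> C"
      using 2(4) s_VB s_H verts_C by (cases "a = []") auto
    then obtain x where x: "x \<in> words (X i)" "val x \<in> amalgamated" "s = act \<theta> x"
      using 2(3) A_orbit_componentE[OF i \<theta>_cos] C_\<theta> by metis
    have "t \<in> VB ?\<Delta> C"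
      using 2(4) t_VB t_H verts_C by (cases "b = []") auto
    then obtain y where y: "y \<in> words (X i)" "val y \<in> amalgamated" "t = act \<theta> y"
      using 2(3) A_orbit_componentE[OF i \<theta>_cos] C_\<theta> by metis
    have Wxy: "x \<in> words amalg_gens" "y \<in> words amalg_gens"
      using factor_words[OF i] x(1) y(1) by auto
    note grp = group_amalg group.is_monoid[OF group_amalg]
    have K: "val (v @ inv_word y) \<in> Lab C \<theta>" if "v \<in> words (X i)" "act \<theta> v = t" for v
    proof -
      have "act \<theta> (v @ inv_word y) = act (act \<theta> v) (inv_word y)"
        using Wxy factor_words[OF i that(1)] \<theta>_cos by (simp add: act_append)
      then have "act \<theta> (v @ inv_word y) = \<theta>" using that(2) y(3) act_inverse[OF \<theta>_cos Wxy(2)] by simp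
      moreover have "v @ inv_word y \<in> words (X i)" using that(1) y(1) by simp
      ultimately show ?thesis unfolding C_\<theta> Lab_component[OF i \<theta>_cos] by blast
    qed
    have "act \<theta> (x @ g) = t" using Wxy W x(3) sv(2) \<theta>_cos by (simp add: act_append)
    then have xgy: "val ((x @ g) @ inv_word y) \<in> Lab C \<theta>" using K[of "x @ g"] x(1) g by simp
    \<comment> \<open>With \<open>s = \<theta> \<cdot> x\<close> and \<open>t = \<theta> \<cdot> y\<close>, the word \<open>x g y\<inverse>\<close> labels a loop at \<open>\<theta>\<close>.\<close>
    have val_g: "val g = inv\<^bsub>amalg\<^esub> val x \<otimes>\<^bsub>amalg\<^esub> val ((x @ g) @ inv_word y) \<otimes>\<^bsub>amalg\<^esub> val y"
    proof -
      have "val g = val (inv_word x @ ((x @ g) @ inv_word y) @ y)"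
        using Wxy W
        by (simp add: val_append val_inv_word monoid.m_assoc[OF grp(2)] monoid.m_closed[OF grp(2)]
          group.inv_closed[OF grp(1)] group.l_inv[OF grp(1)] monoid.r_one[OF grp(2)]
          group.inv_solve_left[OF grp(1)])
      then show ?thesis
        using Wxy W by (simp add: val_append val_inv_word monoid.m_assoc[OF grp(2)] monoid.m_closed[OF grp(2)]
          group.inv_closed[OF grp(1)])
    qed
    have "val ((x @ g) @ inv_word y) \<in> amalgamated" using xgy 2(2) by blast
    then have "val g \<in> amalgamated"
      unfolding val_g using x(2) y(2)
      by (intro subgroup.m_closed[OF subgroup_amalgamated] subgroup.m_inv_closed[OF subgroup_amalgamated])
    \<comment> \<open>Only a syllable that is alone may lie in the amalgamated subgroup.\<close>
    then have "a = [] \<and> b = []" using normal by (auto simp: normal_form_def)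
    then have ab: "s = t" "H \<in> lverts C" using s_H t_H verts_C by auto
    then have triv: "Lab C \<theta> = {\<one>\<^bsub>amalg\<^esub>}" using 2(4) by blast
    have "val (x @ inv_word y) = \<one>\<^bsub>amalg\<^esub>" using K[of x] x ab(1) triv by auto
    then have "val x = val y"
      using Wxy group.inv_equality[OF grp(1), of "val x" "inv\<^bsub>amalg\<^esub> val y"]
      by (simp add: val_append val_inv_word group.inv_closed[OF grp(1)] group.inv_inv[OF grp(1)])
    moreover have "val ((x @ g) @ inv_word y) = \<one>\<^bsub>amalg\<^esub>" using xgy triv by auto
    ultimately have "val g = inv\<^bsub>amalg\<^esub> val y \<otimes>\<^bsub>amalg\<^esub> \<one>\<^bsub>amalg\<^esub> \<otimes>\<^bsub>amalg\<^esub> val y"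
      using val_g by simp
    also have "\<dots> = \<one>\<^bsub>amalg\<^esub>"
      using Wxy by (simp add: group.inv_closed[OF grp(1)] monoid.r_one[OF grp(2)] group.l_inv[OF grp(1)])
    finally show False using g_ne(1) by blast
  qed
qed

text \<open>A nontrivial element of \<open>H\<close> in the amalgamated subgroup is a normal word of length one over
  the other alphabet as well, and its reading starts with an arc at the basepoint.\<close>

lemma base_components:
  assumes i: "i \<in> {1, 2}" and C: "mono_component (X i) (part core_verts core_arcs) C"
    and H: "H \<in> lverts C" and ne: "Lab C H \<inter> amalgamated \<noteq> {\<one>\<^bsub>amalg\<^esub>}"
  shows "\<exists>j\<in>{1, 2}. j \<noteq> i \<and> (\<exists>D. mono_component (X j) (part core_verts core_arcs) D \<and>
    H \<in> lverts D \<and> Lab C H \<inter> amalgamated = Lab D H \<inter> amalgamated)"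
proof -
  have "C = component (X i) H" by (rule core_component_eq(1)[OF i i C H])
  then have Lab_C: "Lab C H \<inter> amalgamated = H \<inter> amalgamated"
    using Lab_component_base_amalgamated[OF i] by simp
  have "\<one>\<^bsub>amalg\<^esub> \<in> H \<inter> amalgamated"
    using subgroup.one_closed[OF subgroup_H] subgroup.one_closed[OF subgroup_amalgamated] by blast
  then obtain x where x: "x \<in> H" "x \<in> amalgamated" "x \<noteq> \<one>\<^bsub>amalg\<^esub>" using ne Lab_C by blast
  define j :: nat where "j = 3 - i"
  have j: "j \<in> {1, 2}" "j \<noteq> i" using i by (auto simp: j_def)
  obtain v where v: "v \<in> words (X j)" "val v = x" using amalgamated_in_factor[OF x(2) j(1)] .
  have "closed_normal ([] @ [v])"
    using v x j(1) by (auto simp: closed_normal_def normal_form_def)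
  moreover obtain l v' where "v = l # v'" using v x by (cases v) auto
  ultimately have l: "(H, l) \<in> core_arcs" "l \<in> letters (X j)"
    using core_arcsI(1)[of "[v]" "[]" l v'] v(1) by auto
  have "mono_component (X j) (part core_verts core_arcs) (component (X j) H)"
    by (rule core_component[OF j(1) j(1) l])
  moreover have "H \<in> lverts (component (X j) H)" by (simp add: component_def)
  ultimately show ?thesis using j Lab_C Lab_component_base_amalgamated[OF j(1)] by blast
qed

end

theorem theorem7p5:
  fixes X :: "nat \<Rightarrow> 'x set"
    and R :: "nat \<Rightarrow> 'x word set"
    and A :: "('a, 'm) monoid_scheme"
    and \<phi> :: "nat \<Rightarrow> 'a \<Rightarrow> 'x word set"
    and H :: "'x word set set"
  assumes "amalgam X R A \<phi>"
    and "subgroup H (amalgam.amalg X R A \<phi>)"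
    and "finitely_generated (amalgam.amalg X R A \<phi>) H"
  shows "amalgam.reduced_precover X R A \<phi> (amalgam.normal_core X R A \<phi> H)
           (H #>\<^bsub>amalgam.amalg X R A \<phi>\<^esub> \<one>\<^bsub>amalgam.amalg X R A \<phi>\<^esub>)
       \<and> amalgam.Lab X R A \<phi> (amalgam.normal_core X R A \<phi> H)
           (H #>\<^bsub>amalgam.amalg X R A \<phi>\<^esub> \<one>\<^bsub>amalgam.amalg X R A \<phi>\<^esub>) = H"
proof -
  interpret amalgam_subgroup X R A \<phi> H
    using assms(1,2) by (simp add: amalgam_subgroup_def amalgam_subgroup_axioms_def)
  show ?thesis
    unfolding base_coset normal_core_eq_part reduced_precover_def
    using precover_core core_not_redundant base_components Lab_core by blast
qed

end
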